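(* For any connected graph $G$ and any integer $r\ge 0$, $$t(L(S_r(G)))=\prod_{v\in V(G)}d(v)^{d(v)-2}\sum_{E'\subseteq E(G)}t(G[E'])\,r^{|E'|-|V(G)|+1}\prod_{e\in E(G)-E'}\left(d(u_e)^{-1}+d(v_e)^{-1}\right),$$ where $d(v)=d_G(v)$ is the degree of $v$ in $G$ and $u_e$ and $v_e$ are the two ends of $e$.
   Context: Graphs have no loops but may have parallel edges. $V(G)$ and $E(G)$ are the vertex set and edge set of $G$; $d_G(v)$ is the number of edges of $G$ incident with $v$. $t(G)$ is the number of spanning trees of $G$ (so $t(G)=0$ if $G$ is disconnected). For $E'\subseteq E(G)$, $G[E']$ is the spanning subgraph of $G$ with vertex set $V(G)$ and edge set $E'$. $L(G)$ is the line graph of $G$: its vertices are the edges of $G$, and two distinct edges of $G$ are joined in $L(G)$ by as many edges as they have common ends (so two parallel edges of $G$ are joined by two parallel edges in $L(G)$). $S_r(G)$ is the graph obtained from $G$ by replacing each edge $e$ of $G$ by a path of length $r+1$ connecting the two ends of $e$ (so $S_0(G)=G$). For $r=0$ the sum is read with $0^0=1$, and a summand with $t(G[E'])=0$ is $0$ (note that $t(G[E'])\neq 0$ forces $|E'|\ge |V(G)|-1$), so that only the edge sets $E'$ of spanning trees of $G$ contribute. *)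

theory Defs
  imports Complex_Main
begin

text \<open>
  Undirected multigraphs: edges are named objects, so distinct edges may have the same
  set of ends.
\<close>

record ('v, 'e) multigraph =
  verts :: "'v set"
  edges :: "'e set"
  ends :: "'e \<Rightarrow> 'v set"

definition graph :: "('v, 'e) multigraph \<Rightarrow> bool" where
  "graph G \<longleftrightarrow> finite (verts G) \<and> finite (edges G) \<and>
     (\<forall>e\<in>edges G. ends G e \<subseteq> verts G \<and> card (ends G e) = 2)"

definition degree :: "('v, 'e) multigraph \<Rightarrow> 'v \<Rightarrow> nat" where
  "degree G v = card {e \<in> edges G. v \<in> ends G e}"

definition adjacency :: "('v, 'e) multigraph \<Rightarrow> ('v \<times> 'v) set" where
  "adjacency G = {(x, y). \<exists>e\<in>edges G. ends G e = {x, y}}"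

text \<open>The graph without vertices counts as disconnected, hence is not a tree.\<close>

definition connected_graph :: "('v, 'e) multigraph \<Rightarrow> bool" where
  "connected_graph G \<longleftrightarrow> verts G \<noteq> {} \<and>
     (\<forall>x\<in>verts G. \<forall>y\<in>verts G. (x, y) \<in> (adjacency G)\<^sup>*)"

text \<open>
  The cycle visits \<open>vs ! 0\<close>, \<open>es ! 0\<close>, \<open>vs ! 1\<close>, \<open>es ! 1\<close>, and so on, cyclically.
  Two parallel edges form a cycle of length 2; since the edges are distinct,
  traversing one edge back and forth does not.
\<close>

definition is_cycle :: "('v, 'e) multigraph \<Rightarrow> 'v list \<Rightarrow> 'e list \<Rightarrow> bool" where
  "is_cycle G vs es \<longleftrightarrow> es \<noteq> [] \<and> length vs = length es \<and> distinct vs \<and> distinct es \<and>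
     set es \<subseteq> edges G \<and>
     (\<forall>i<length es. ends G (es ! i) = {vs ! i, vs ! (Suc i mod length es)})"

definition is_tree :: "('v, 'e) multigraph \<Rightarrow> bool" where
  "is_tree G \<longleftrightarrow> connected_graph G \<and> (\<nexists>vs es. is_cycle G vs es)"

definition spanning_subgraph :: "('v, 'e) multigraph \<Rightarrow> 'e set \<Rightarrow> ('v, 'e) multigraph" where
  "spanning_subgraph G E' = G\<lparr>edges := E'\<rparr>"

definition num_spanning_trees :: "('v, 'e) multigraph \<Rightarrow> nat" where
  "num_spanning_trees G = card {T. T \<subseteq> edges G \<and> is_tree (spanning_subgraph G T)}"

text \<open>
  An edge of the line graph is a pair of an unordered pair of distinct edges of \<open>G\<close> and one
  common end of these, so two edges of \<open>G\<close> are joined once for each common end.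
\<close>

definition line_graph :: "('v, 'e) multigraph \<Rightarrow> ('e, 'e set \<times> 'v) multigraph" where
  "line_graph G =
     \<lparr>verts = edges G,
      edges = {({e, f}, w) | e f w.
                 e \<in> edges G \<and> f \<in> edges G \<and> e \<noteq> f \<and> w \<in> ends G e \<inter> ends G f},
      ends = fst\<rparr>"

text \<open>
  The functions \<open>u\<close> and \<open>v\<close> name the two ends of each edge of \<open>G\<close>
  (in an order that does not matter up to isomorphism).  The path replacing \<open>e\<close> has
  the vertices \<open>path_vertex r u v e i\<close> for \<open>i = 0, \<dots>, r + 1\<close> and the edges \<open>(e, i)\<close> for
  \<open>i = 0, \<dots>, r\<close>.
\<close>

definition path_vertex ::
    "nat \<Rightarrow> ('e \<Rightarrow> 'v) \<Rightarrow> ('e \<Rightarrow> 'v) \<Rightarrow> 'e \<Rightarrow> nat \<Rightarrow> 'v + 'e \<times> nat" where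
  "path_vertex r u v e i =
     (if i = 0 then Inl (u e) else if i = r + 1 then Inl (v e) else Inr (e, i))"

definition subdivision ::
    "nat \<Rightarrow> ('e \<Rightarrow> 'v) \<Rightarrow> ('e \<Rightarrow> 'v) \<Rightarrow> ('v, 'e) multigraph \<Rightarrow>
     ('v + 'e \<times> nat, 'e \<times> nat) multigraph" where
  "subdivision r u v G =
     \<lparr>verts = Inl ` verts G \<union> Inr ` (edges G \<times> {1..r}),
      edges = edges G \<times> {0..r},
      ends = (\<lambda>(e, i). {path_vertex r u v e i, path_vertex r u v e (i + 1)})\<rparr>"

end

theory Submission
  imports Defs "HOL-Combinatorics.Permutations"
begin

text \<open>
  By the matrix-tree theorem, weighted spanning tree sums are principal minors of Laplacians, and
  eliminating vertices from the Laplacian (Schur complements) realises the classical equivalences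
  of electrical networks.  For a graph \<open>H\<close>, give each edge of its incidence graph at the vertex
  \<open>x\<close> the weight \<open>d(x)\<close>.  Eliminating the vertices of \<open>H\<close> (star-mesh transformation)
  turns the incidence graph into \<open>L(H)\<close> with unit weights; eliminating the edges of \<open>H\<close> instead
  turns it into \<open>H\<close> where \<open>e\<close> has resistance \<open>1/d(u_e) + 1/d(v_e)\<close>.  For \<open>H = S_r(G)\<close>, the
  resistances along the path replacing \<open>e\<close> add up to \<open>r + 1/d(u_e) + 1/d(v_e)\<close>, and expanding
  the product of these sums over the edges outside a spanning tree of \<open>G\<close> gives the formula.
\<close>

text \<open>The weight d(x) is forced: eliminating the centre of a star of k edges of conductance c
  joins every two leaves by conductance c*c/(k*c) = c/k, and this is 1 only for c = k. The prefactor
  comes from the pivots. A vertex x has the pivot d(x)*d(x). An edge e has the pivot d(u_e) +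
  d(v_e), which is d(u_e)*d(v_e) times the resistance of e, and the factors d(u_e)*d(v_e) multiply
  over all edges to the product of d(x)^d(x). Dividing one evaluation by the other leaves the
  exponent d(x) - 2, which is 0 at the subdividing vertices. The grounded vertex must survive the
  elimination, so the same tree sum is written as a minor in two ways: grounded at an edge of H when
  the vertices go, and at a vertex of H when the edges go. An edgeless G offers no edge to ground
  and is treated apart. Deletion and contraction occur only in the matrix-tree theorem. There
  contraction merges a vertex with the ground, which merely shrinks the index set of the minor, so
  vertex types and ends stay fixed.\<close>

section \<open>Determinants over finite index sets\<close>

text \<open>Arbitrary finite index sets let vertices name rows and columns without an enumeration,
  and a principal minor is the same function on a smaller set.\<close>

definition set_det :: "'i set \<Rightarrow> ('i \<Rightarrow> 'i \<Rightarrow> real) \<Rightarrow> real" where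
  "set_det U A = (\<Sum>p | p permutes U. of_int (sign p) * (\<Prod>i\<in>U. A i (p i)))"

lemma set_det_empty [simp]: "set_det {} A = 1"
  by (simp add: set_det_def)

lemma set_det_cong:
  assumes "\<And>i j. i \<in> U \<Longrightarrow> j \<in> U \<Longrightarrow> A i j = B i j"
  shows "set_det U A = set_det U B"
  unfolding set_det_def
  by (intro sum.cong refl arg_cong2[where f = "(*)"] prod.cong)
    (auto simp: assms permutes_in_image)

text \<open>Conjugating permutations by \<open>f\<close> preserves signs. This strips the
  constructors \<open>Inl\<close> and \<open>Inr\<close> from the vertices that survive an
  elimination.\<close>

lemma set_det_image:
  assumes "inj_on f U" "finite U"
  shows "set_det (f ` U) A = set_det U (\<lambda>i j. A (f i) (f j))"
proof -
  have bij: "bij_betw f U (f ` U)"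
    using assms by (simp add: bij_betw_imageI)
  have bij': "bij_betw (inv_into U f) (f ` U) U"
    using bij by (rule bij_betw_inv_into)
  show ?thesis
    unfolding set_det_def
  proof (rule sum.reindex_bij_witness[symmetric, where
        i = "map_permutation (f ` U) (inv_into U f)" and j = "map_permutation U f"])
    fix p assume "p \<in> {p. p permutes U}"
    then have p: "p permutes U" by simp
    show "map_permutation (f ` U) (inv_into U f) (map_permutation U f p) = p"
      by (rule map_permutation_compose_inv[OF bij p]) (simp add: assms)
    show "map_permutation U f p \<in> {p. p permutes f ` U}"
      using map_permutation_permutes[OF bij p] by simp
    have "(\<Prod>i\<in>f ` U. A i (map_permutation U f p i)) = (\<Prod>i\<in>U. A (f i) (f (p i)))"
      by (simp add: prod.reindex assms map_permutation_apply)
    then show "of_int (sign (map_permutation U f p)) * (\<Prod>i\<in>f ` U. A i (map_permutation U f p i)) =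
        of_int (sign p) * (\<Prod>i\<in>U. A (f i) (f (p i)))"
      by (simp add: sign_map_permutation assms p)
  next
    fix q assume "q \<in> {p. p permutes f ` U}"
    then have q: "q permutes f ` U" by simp
    show "map_permutation U f (map_permutation (f ` U) (inv_into U f) q) = q"
      by (rule map_permutation_compose_inv[OF bij' q]) (simp add: f_inv_into_f)
    show "map_permutation (f ` U) (inv_into U f) q \<in> {p. p permutes U}"
      using map_permutation_permutes[OF bij' q] by simp
  qed
qed

lemma set_det_row_add:
  assumes "finite U" "k \<in> U"
  shows "set_det U (A(k := \<lambda>j. a j + c * b j)) = set_det U (A(k := a)) + c * set_det U (A(k := b))"
proof -
  have split: "(\<Prod>i\<in>U. (A(k := r)) i (p i)) = r (p k) * (\<Prod>i\<in>U - {k}. A i (p i))" for r p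
    by (subst prod.remove[OF assms]) (auto intro!: prod.cong)
  show ?thesis
    unfolding set_det_def split sum_distrib_left sum.distrib[symmetric]
    by (intro sum.cong) (auto simp: algebra_simps)
qed

text \<open>Precomposing every permutation with the transposition of \<open>k\<close> and
  \<open>l\<close> flips its sign but keeps its product, so the determinant equals its own
  negative.\<close>

lemma set_det_same_rows:
  assumes "finite U" "k \<in> U" "l \<in> U" "k \<noteq> l" "\<And>j. j \<in> U \<Longrightarrow> A k j = A l j"
  shows "set_det U A = 0"
proof -
  let ?t = "Transposition.transpose k l"
  have t: "?t permutes U"
    using assms by (simp add: permutes_swap_id)
  have "set_det U A = (\<Sum>p | p permutes U. of_int (sign (p \<circ> ?t)) * (\<Prod>i\<in>U. A i ((p \<circ> ?t) i)))"
    unfolding set_det_def by (rule sum_permutations_compose_right[OF t])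
  also have "\<dots> = (\<Sum>p | p permutes U. - (of_int (sign p) * (\<Prod>i\<in>U. A i (p i))))"
  proof (rule sum.cong[OF refl])
    fix p assume "p \<in> {p. p permutes U}"
    then have p: "p permutes U" by simp
    have "sign (p \<circ> ?t) = - sign p"
      using assms p t by (subst sign_compose) (auto simp: permutation_permutes sign_swap_id)
    moreover have "(\<Prod>i\<in>U. A i ((p \<circ> ?t) i)) = (\<Prod>i\<in>U. A (?t i) (p i))"
      using t by (subst prod.permute[OF t]) (simp add: o_def)
    moreover have "(\<Prod>i\<in>U. A (?t i) (p i)) = (\<Prod>i\<in>U. A i (p i))"
      by (rule prod.cong) (use assms p in \<open>auto simp: transpose_def permutes_in_image\<close>)
    ultimately show "of_int (sign (p \<circ> ?t)) * (\<Prod>i\<in>U. A i ((p \<circ> ?t) i)) =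
        - (of_int (sign p) * (\<Prod>i\<in>U. A i (p i)))"
      by simp
  qed
  also have "\<dots> = - set_det U A"
    by (simp add: set_det_def sum_negf)
  finally show ?thesis by simp
qed

lemma set_det_row_op:
  assumes "finite U" "k \<in> U" "l \<in> U" "k \<noteq> l"
  shows "set_det U (A(k := \<lambda>j. A k j + c * A l j)) = set_det U A"
proof -
  have "set_det U (A(k := A l)) = 0"
    by (rule set_det_same_rows[OF assms]) (use assms in auto)
  then show ?thesis
    using set_det_row_add[OF assms(1,2), of A "A k" c "A l"] by simp
qed

text \<open>Adding all other rows, one at a time, to a fixed row \<open>k\<close> turns that row
  into zero. It serves for Laplacian minors on a set that no edge leaves.\<close>

lemma set_det_col_sums_zero:
  assumes "finite U" "U \<noteq> {}" "\<And>j. j \<in> U \<Longrightarrow> (\<Sum>i\<in>U. A i j) = 0"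
  shows "set_det U A = 0"
proof -
  obtain k where k: "k \<in> U" using assms by auto
  have "S \<subseteq> U - {k} \<Longrightarrow> set_det U (A(k := \<lambda>j. A k j + (\<Sum>i\<in>S. A i j))) = set_det U A" for S
  proof (induction S rule: infinite_finite_induct)
    case (insert l S)
    let ?B = "A(k := \<lambda>j. A k j + (\<Sum>i\<in>S. A i j))"
    have "set_det U (?B(k := \<lambda>j. ?B k j + 1 * ?B l j)) = set_det U ?B"
      by (rule set_det_row_op) (use assms k insert in auto)
    moreover have "?B(k := \<lambda>j. ?B k j + 1 * ?B l j) = A(k := \<lambda>j. A k j + (\<Sum>i\<in>insert l S. A i j))"
      using insert by (auto simp: fun_eq_iff)
    moreover have "set_det U ?B = set_det U A"
      using insert by blast
    ultimately show ?case by (simp only:)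
  qed (use assms finite_subset in auto)
  from this[of "U - {k}"]
  have "set_det U A = set_det U (A(k := \<lambda>j. \<Sum>i\<in>U. A i j))"
    using assms k by (simp add: sum.remove[of U k])
  also have "\<dots> = 0"
  proof -
    have "(\<Prod>i\<in>U. (A(k := \<lambda>j. \<Sum>i\<in>U. A i j)) i (p i)) = 0" if "p permutes U" for p
      by (rule prod_zero) (use assms k that in \<open>auto simp: permutes_in_image intro!: bexI[of _ k]\<close>)
    then show ?thesis by (simp add: set_det_def)
  qed
  finally show ?thesis .
qed

lemma sum_permutes_fixing:
  assumes "finite U" "k \<in> U"
  shows "(\<Sum>p | p permutes U \<and> p k = k. of_int (sign p) * (\<Prod>i\<in>U. A i (p i))) =
    A k k * set_det (U - {k}) A"
proof -
  have eq: "{p. p permutes U \<and> p k = k} = {p. p permutes (U - {k})}"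
  proof (intro set_eqI iffI; clarsimp)
    fix p assume "p permutes U" "p k = k"
    then show "p permutes (U - {k})"
      by (auto intro: permutes_superset)
  next
    fix p assume "p permutes (U - {k})"
    then show "p permutes U \<and> p k = k"
      by (auto intro: permutes_subset simp: permutes_not_in)
  qed
  have "(\<Prod>i\<in>U. A i (p i)) = A k k * (\<Prod>i\<in>U - {k}. A i (p i))" if "p permutes (U - {k})" for p
    using assms that by (subst prod.remove[of U k]) (auto simp: permutes_not_in)
  then show ?thesis
    unfolding eq set_det_def sum_distrib_left by (intro sum.cong) auto
qed

lemma set_det_column_unit:
  assumes "finite U" "k \<in> U" "\<And>i. i \<in> U \<Longrightarrow> i \<noteq> k \<Longrightarrow> A i k = 0"
  shows "set_det U A = A k k * set_det (U - {k}) A"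
proof -
  have "set_det U A = (\<Sum>p | p permutes U \<and> p k = k. of_int (sign p) * (\<Prod>i\<in>U. A i (p i)))"
    unfolding set_det_def
  proof (rule sum.mono_neutral_right)
    show "\<forall>p \<in> {p. p permutes U} - {p. p permutes U \<and> p k = k}.
        of_int (sign p) * (\<Prod>i\<in>U. A i (p i)) = 0"
    proof
      fix p assume "p \<in> {p. p permutes U} - {p. p permutes U \<and> p k = k}"
      then have p: "p permutes U" "p k \<noteq> k" by auto
      \<comment> \<open>The row that \<open>p\<close> sends to column \<open>k\<close> is
        \<open>inv p k\<close>; it differs from \<open>k\<close>, so its entry there
        vanishes.\<close>
      have "\<exists>i\<in>U. A i (p i) = 0"
      proof (rule bexI[of _ "inv p k"])
        have "inv p k \<noteq> k"
          using p by (metis permutes_inverses(1))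
        then show "A (inv p k) (p (inv p k)) = 0"
          using assms p by (simp add: permutes_inverses permutes_in_image permutes_inv)
        show "inv p k \<in> U"
          using assms p by (simp add: permutes_in_image permutes_inv)
      qed
      then show "of_int (sign p) * (\<Prod>i\<in>U. A i (p i)) = 0"
        using assms prod_zero by fastforce
    qed
  qed (use assms finite_permutations in auto)
  then show ?thesis
    using sum_permutes_fixing[OF assms(1,2)] by simp
qed

text \<open>This is deletion-contraction on the determinant side: an edge from \<open>k\<close> to
  the ground changes only the entry at \<open>(k, k)\<close>.\<close>

lemma set_det_diagonal_add:
  assumes "finite U" "k \<in> U"
  shows "set_det U (\<lambda>i j. A i j + (if i = k \<and> j = k then c else 0)) =
    set_det U A + c * set_det (U - {k}) A"
proof -
  let ?d = "\<lambda>j. if j = k then 1 else (0::real)"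
  have eq: "(\<lambda>i j. A i j + (if i = k \<and> j = k then c else 0)) = A(k := \<lambda>j. A k j + c * ?d j)"
    by (auto simp: fun_eq_iff)
  have "set_det U (A(k := ?d)) =
      (\<Sum>p | p permutes U \<and> p k = k. of_int (sign p) * (\<Prod>i\<in>U. (A(k := ?d)) i (p i)))"
    unfolding set_det_def
  proof (rule sum.mono_neutral_right)
    show "\<forall>p \<in> {p. p permutes U} - {p. p permutes U \<and> p k = k}.
        of_int (sign p) * (\<Prod>i\<in>U. (A(k := ?d)) i (p i)) = 0"
      using assms by (auto intro!: prod_zero bexI[of _ k])
  qed (use assms finite_permutations in auto)
  also have "\<dots> = set_det (U - {k}) (A(k := ?d))"
    using sum_permutes_fixing[OF assms, of "A(k := ?d)"] by simp
  also have "\<dots> = set_det (U - {k}) A"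
    by (rule set_det_cong) auto
  finally show ?thesis
    unfolding eq set_det_row_add[OF assms] by simp
qed

section \<open>Schur complements\<close>

lemma set_det_schur_single:
  assumes "finite U" "z \<notin> U" "A z z \<noteq> 0"
  shows "set_det (insert z U) A = A z z * set_det U (\<lambda>i j. A i j - A i z * A z j / A z z)"
proof -
  \<comment> \<open>\<open>B S\<close> is the matrix after column \<open>z\<close> has been cleared
    in the rows of \<open>S\<close> only, so that the elimination can proceed row by row.\<close>
  define B where "B S i j = (if i \<in> S then A i j - A i z * A z j / A z z else A i j)" for S i j
  have "S \<subseteq> U \<Longrightarrow> set_det (insert z U) (B S) = set_det (insert z U) A" for S
  proof (induction S rule: infinite_finite_induct)
    case (insert l S)
    have "set_det (insert z U) ((B S)(l := \<lambda>j. B S l j + (- A l z / A z z) * B S z j)) =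
        set_det (insert z U) (B S)"
      by (rule set_det_row_op) (use assms insert in auto)
    moreover have "(B S)(l := \<lambda>j. B S l j + (- A l z / A z z) * B S z j) = B (insert l S)"
      using insert assms by (auto simp: B_def fun_eq_iff)
    ultimately show ?case using insert by auto
  next
    case (infinite S) then show ?case using assms finite_subset by auto
  next
    case empty then show ?case by (simp add: B_def[abs_def])
  qed
  then have "set_det (insert z U) A = set_det (insert z U) (B U)" by simp
  also have "\<dots> = B U z z * set_det (insert z U - {z}) (B U)"
    by (rule set_det_column_unit) (use assms in \<open>auto simp: B_def\<close>)
  also have "insert z U - {z} = U" using assms by simp
  also have "set_det U (B U) = set_det U (\<lambda>i j. A i j - A i z * A z j / A z z)"
    by (rule set_det_cong) (simp add: B_def)
  finally show ?thesis using assms by (simp add: B_def)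
qed

text \<open>As the block on \<open>Z\<close> is diagonal, eliminating one index of \<open>Z\<close>
  leaves the rows and columns of the others unchanged (\<open>AB\<close>). Hence the corrections
  simply add up and the pivots are the original diagonal entries.\<close>

lemma set_det_schur:
  assumes "finite Z" "finite U" "Z \<inter> U = {}"
    and "\<And>z. z \<in> Z \<Longrightarrow> A z z \<noteq> 0"
    and "\<And>y z. y \<in> Z \<Longrightarrow> z \<in> Z \<Longrightarrow> y \<noteq> z \<Longrightarrow> A y z = 0"
  shows "set_det (Z \<union> U) A =
    (\<Prod>z\<in>Z. A z z) * set_det U (\<lambda>i j. A i j - (\<Sum>z\<in>Z. A i z * A z j / A z z))"
  using assms
proof (induction Z arbitrary: A rule: finite_induct)
  case (insert x Z)
  define B where "B i j = A i j - A i x * A x j / A x x" for i j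
  have AB: "B z j = A z j" "B j z = A j z" if "z \<in> Z" for z j
    using insert.prems insert.hyps that by (auto simp: B_def)
  have "set_det (insert x Z \<union> U) A = A x x * set_det (Z \<union> U) B"
    unfolding B_def
    using set_det_schur_single[of "Z \<union> U" x A] insert.prems insert.hyps by simp
  also have "set_det (Z \<union> U) B =
      (\<Prod>z\<in>Z. B z z) * set_det U (\<lambda>i j. B i j - (\<Sum>z\<in>Z. B i z * B z j / B z z))"
    using insert.prems AB by (intro insert.IH) auto
  also have "(\<Prod>z\<in>Z. B z z) = (\<Prod>z\<in>Z. A z z)"
    by (intro prod.cong) (auto simp: AB)
  also have "(\<lambda>i j. B i j - (\<Sum>z\<in>Z. B i z * B z j / B z z)) =
      (\<lambda>i j. A i j - (\<Sum>z\<in>insert x Z. A i z * A z j / A z z))"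
    using insert.hyps by (simp add: AB) (simp add: B_def diff_diff_eq)
  finally show ?case using insert.hyps by simp
qed simp

section \<open>Rooted forests and the matrix-tree theorem\<close>

text \<open>All vertices outside \<open>U\<close> together form the ground. Contracting an edge into
  the ground then means removing its end from \<open>U\<close>, without forming a quotient
  graph.\<close>

inductive grounded :: "('e \<Rightarrow> 'v set) \<Rightarrow> 'e set \<Rightarrow> 'v set \<Rightarrow> 'v \<Rightarrow> bool"
  for d :: "'e \<Rightarrow> 'v set" and T :: "'e set" and U :: "'v set" where
  base: "x \<notin> U \<Longrightarrow> grounded d T U x"
| step: "e \<in> T \<Longrightarrow> d e = {x, y} \<Longrightarrow> grounded d T U y \<Longrightarrow> grounded d T U x"

lemma grounded_crossing_edge:
  "grounded d T U x \<Longrightarrow> x \<in> U \<Longrightarrow> \<exists>e\<in>T. \<exists>r y. d e = {r, y} \<and> r \<notin> U \<and> y \<in> U"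
proof (induction rule: grounded.induct)
  case (step e x y)
  show ?case
  proof (cases "y \<in> U")
    case False
    have "d e = {y, x}" using step by (simp add: insert_commute)
    then show ?thesis using False step by blast
  qed (use step in blast)
qed simp

text \<open>Dropping \<open>x\<close> from \<open>U\<close> grounds it directly, which is all that
  \<open>e\<close> could achieve: a path using \<open>e\<close> may stop as soon as it meets
  \<open>r\<close> or \<open>x\<close>.\<close>

lemma grounded_contract:
  assumes "e \<in> T" "d e = {r, x}" "r \<notin> U" "x \<in> U"
  shows "grounded d T U y \<longleftrightarrow> grounded d (T - {e}) (U - {x}) y"
proof
  assume "grounded d T U y"
  then show "grounded d (T - {e}) (U - {x}) y"
  proof induction
    case (step f y z)
    show ?case
    proof (cases "f = e")
      case True
      then have "y \<notin> U - {x}" using step assms by (auto simp: doubleton_eq_iff)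
      then show ?thesis by (rule grounded.base)
    qed (use step in \<open>auto intro: grounded.step\<close>)
  qed (auto intro: grounded.base)
next
  assume "grounded d (T - {e}) (U - {x}) y"
  then show "grounded d T U y"
  proof induction
    case (base y)
    moreover have "grounded d T U x"
      using assms by (intro grounded.step[of e _ _ x r] grounded.base) (simp_all add: insert_commute)
    ultimately show ?case by (auto intro: grounded.base)
  qed (auto intro: grounded.step)
qed

text \<open>
  The edge count replaces acyclicity: such a \<open>T\<close> is a spanning forest in which each
  component contains exactly one vertex outside \<open>U\<close>.
\<close>

definition rooted_forest :: "('e \<Rightarrow> 'v set) \<Rightarrow> 'v set \<Rightarrow> 'e set \<Rightarrow> bool" where
  "rooted_forest d U T \<longleftrightarrow> card T = card U \<and> (\<forall>x\<in>U. grounded d T U x)"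

lemma rooted_forest_contract:
  assumes "finite T" "finite U" "e \<in> T" "d e = {r, x}" "r \<notin> U" "x \<in> U"
  shows "rooted_forest d U T \<longleftrightarrow> rooted_forest d (U - {x}) (T - {e})"
proof -
  have "card T = card U \<longleftrightarrow> card (T - {e}) = card (U - {x})"
    using assms by (metis card_Suc_Diff1 nat.inject)
  moreover have "grounded d (T - {e}) (U - {x}) x"
    by (rule grounded.base) simp
  ultimately show ?thesis
    unfolding rooted_forest_def grounded_contract[where d = d, OF assms(3-6)] by auto
qed

text \<open>While \<open>U\<close> is nonempty some edge crosses to the ground. Contracting it
  spends one edge and grounds one vertex, and the edges spent in this way form the forest
  \<open>S\<close>.\<close>

lemma grounded_forest:
  assumes "finite T" "finite U" "\<forall>x\<in>U. grounded d T U x"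
  shows "card U \<le> card T \<and> (\<exists>S\<subseteq>T. rooted_forest d U S)"
  using assms
proof (induction T arbitrary: U rule: finite_psubset_induct)
  case (psubset T)
  show ?case
  proof (cases "U = {}")
    case True
    then show ?thesis by (auto simp: rooted_forest_def intro!: exI[of _ "{}"])
  next
    case False
    then obtain e r x where e: "e \<in> T" "d e = {r, x}" "r \<notin> U" "x \<in> U"
      using psubset.prems grounded_crossing_edge by (metis ex_in_conv)
    have g: "\<forall>y\<in>U - {x}. grounded d (T - {e}) (U - {x}) y"
      using psubset.prems grounded_contract[where d = d, OF e] by auto
    have "T - {e} \<subset> T" using e by auto
    then obtain S where S: "card (U - {x}) \<le> card (T - {e})" "S \<subseteq> T - {e}"
        "rooted_forest d (U - {x}) S"
      using psubset.IH[OF _ _ g] psubset.prems by auto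
    have "finite (insert e S)"
      using S psubset.hyps by (meson finite_insert finite_subset finite_Diff)
    moreover have "insert e S - {e} = S" using S by auto
    ultimately have "rooted_forest d U (insert e S)"
      using rooted_forest_contract[of "insert e S" U e d r x] e S psubset by auto
    moreover have "card U \<le> card T"
      using S e psubset by (metis Suc_le_mono card_Suc_Diff1)
    ultimately show ?thesis
      using S e by (intro conjI exI[of _ "insert e S"]) auto
  qed
qed

section \<open>Laplacians and the matrix-tree theorem\<close>

text \<open>Summing over edges, rather than giving degrees and multiplicities, lets a single edge be
  split off and lets Schur corrections be matched edge by edge.\<close>

definition laplacian :: "('e \<Rightarrow> 'v set) \<Rightarrow> 'e set \<Rightarrow> ('e \<Rightarrow> real) \<Rightarrow> 'v \<Rightarrow> 'v \<Rightarrow> real" where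
  "laplacian d E w i j =
     (\<Sum>e\<in>E. w e * (if i = j then of_bool (i \<in> d e) else - of_bool (d e = {i, j})))"

lemma laplacian_sym: "laplacian d E w i j = laplacian d E w j i"
  by (auto simp: laplacian_def insert_commute intro!: sum.cong)

text \<open>Both sides obey the same recurrence for an edge \<open>e\<close> from \<open>x\<close>
  in \<open>U\<close> to the ground: forests avoiding \<open>e\<close> keep \<open>U\<close>,
  forests containing \<open>e\<close> correspond to forests for \<open>U - {x}\<close>. The edge is
  chosen at the ground so that it enters the minor only at \<open>(x, x)\<close>. If no such edge
  exists and \<open>U\<close> is nonempty, both sides are zero.\<close>

theorem matrix_tree:
  assumes "finite E" "finite U" "\<And>e. e \<in> E \<Longrightarrow> card (d e) = 2"
  shows "(\<Sum>T | T \<subseteq> E \<and> rooted_forest d U T. \<Prod>e\<in>T. w e) = set_det U (laplacian d E w)"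
  using assms
proof (induction E arbitrary: U rule: finite_psubset_induct)
  case (psubset E)
  show ?case
  proof (cases "\<exists>e\<in>E. \<exists>r x. d e = {r, x} \<and> r \<notin> U \<and> x \<in> U")
    case True
    then obtain e r x where e: "e \<in> E" "d e = {r, x}" "r \<notin> U" "x \<in> U" by blast
    let ?E = "E - {e}"
    have IH: "(\<Sum>T | T \<subseteq> ?E \<and> rooted_forest d U' T. \<Prod>e\<in>T. w e) = set_det U' (laplacian d ?E w)"
      if "finite U'" for U'
      using psubset.IH[of ?E U'] psubset.prems e that by auto
    have lap: "laplacian d E w i j = laplacian d ?E w i j + (if i = x \<and> j = x then w e else 0)"
      if "i \<in> U" "j \<in> U" for i j
      using that e psubset.hyps unfolding laplacian_def
      by (subst sum.remove[OF _ e(1)]) (auto simp: doubleton_eq_iff)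
    have split: "{T. T \<subseteq> E \<and> rooted_forest d U T} =
        {T. T \<subseteq> ?E \<and> rooted_forest d U T} \<union>
        insert e ` {T. T \<subseteq> ?E \<and> rooted_forest d (U - {x}) T}" (is "_ = ?A \<union> insert e ` ?B")
    proof -
      have contract: "rooted_forest d U T \<longleftrightarrow> rooted_forest d (U - {x}) (T - {e})"
        if "T \<subseteq> E" "e \<in> T" for T
        using that e psubset by (intro rooted_forest_contract) (auto intro: finite_subset)
      have "T \<in> insert e ` ?B" if "T \<subseteq> E" "e \<in> T" "rooted_forest d U T" for T
        using that contract[OF that(1,2)] by (intro image_eqI[of _ _ "T - {e}"]) auto
      moreover have "rooted_forest d U (insert e T)"
        if "T \<subseteq> ?E" "rooted_forest d (U - {x}) T" for T
      proof -
        have "insert e T - {e} = T" using that by auto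
        then show ?thesis using contract[of "insert e T"] that e by auto
      qed
      ultimately show ?thesis using e by blast
    qed
    have fin: "finite ?A" "finite ?B"
      using psubset.hyps by (auto intro: finite_subset[of _ "Pow E"])
    have "(\<Sum>T | T \<subseteq> E \<and> rooted_forest d U T. \<Prod>e\<in>T. w e) =
        (\<Sum>T\<in>?A. \<Prod>e\<in>T. w e) + (\<Sum>T\<in>insert e ` ?B. \<Prod>e\<in>T. w e)"
      unfolding split by (rule sum.union_disjoint) (use fin in auto)
    also have "(\<Sum>T\<in>insert e ` ?B. \<Prod>e\<in>T. w e) = (\<Sum>T\<in>?B. \<Prod>e\<in>insert e T. w e)"
      by (subst sum.reindex) (auto simp: inj_on_def)
    also have "\<dots> = (\<Sum>T\<in>?B. w e * (\<Prod>e\<in>T. w e))"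
      using psubset.hyps by (intro sum.cong refl prod.insert) (auto intro: finite_subset)
    also have "(\<Sum>T\<in>?A. \<Prod>e\<in>T. w e) = set_det U (laplacian d ?E w)"
      using psubset.prems by (intro IH)
    also have "(\<Sum>T\<in>?B. w e * (\<Prod>e\<in>T. w e)) = w e * set_det (U - {x}) (laplacian d ?E w)"
      using psubset.prems by (simp add: IH sum_distrib_left[symmetric])
    also have "set_det U (laplacian d ?E w) + w e * set_det (U - {x}) (laplacian d ?E w) =
        set_det U (laplacian d E w)"
      using set_det_diagonal_add[of U x "laplacian d ?E w" "w e"] psubset.prems e
      by (simp add: set_det_cong[OF lap])
    finally show ?thesis .
  next
    case False
    show ?thesis
    proof (cases "U = {}")
      case True
      then have "{T. T \<subseteq> E \<and> rooted_forest d U T} = {{}}"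
        using psubset.hyps by (auto simp: rooted_forest_def) (metis card_0_eq empty_iff finite_subset)
      then show ?thesis using True by simp
    next
      case U: False
      have "\<not> rooted_forest d U T" if "T \<subseteq> E" for T
        using False U that unfolding rooted_forest_def by (meson all_not_in_conv grounded_crossing_edge subsetD)
      then have "{T. T \<subseteq> E \<and> rooted_forest d U T} = {}" by auto
      \<comment> \<open>No edge leaves \<open>U\<close>, so every edge at \<open>j\<close> has its
        other end in \<open>U\<close>, and there its off-diagonal entry cancels its share of the
        diagonal.\<close>
      moreover have "set_det U (laplacian d E w) = 0"
      proof (rule set_det_col_sums_zero)
        fix j assume j: "j \<in> U"
        have "(\<Sum>i\<in>U. laplacian d E w i j) = (\<Sum>e\<in>E. w e *
            (\<Sum>i\<in>U. if i = j then of_bool (i \<in> d e) else - of_bool (d e = {i, j})))"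
          unfolding laplacian_def by (subst sum.swap) (simp add: sum_distrib_left)
        also have "\<dots> = (\<Sum>e\<in>E. w e * 0)"
        proof (intro sum.cong refl arg_cong2[where f = "(*)"])
          fix e assume e: "e \<in> E"
          have split: "(\<Sum>i\<in>U. if i = j then of_bool (i \<in> d e) else - of_bool (d e = {i, j})) =
              of_bool (j \<in> d e) - (\<Sum>i\<in>U - {j}. of_bool (d e = {i, j}) :: real)"
          proof -
            have "(\<Sum>i\<in>U - {j}. if i = j then of_bool (i \<in> d e) else - of_bool (d e = {i, j})) =
                (\<Sum>i\<in>U - {j}. - (of_bool (d e = {i, j}) :: real))"
              by (rule sum.cong) auto
            then show ?thesis
              unfolding sum.remove[OF psubset.prems(1) j] sum_negf by simp
          qed
          show "(\<Sum>i\<in>U. if i = j then of_bool (i \<in> d e) else - of_bool (d e = {i, j})) = (0::real)"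
          proof (cases "j \<in> d e")
            case True
            then obtain k where k: "d e = {k, j}" "k \<noteq> j"
              using psubset.prems(2)[OF e] by (auto simp: card_2_iff doubleton_eq_iff)
            then have "k \<in> U - {j}" using False e j by auto
            moreover have "(of_bool (d e = {i, j}) :: real) = (if i = k then 1 else 0)" for i
              using k by (auto simp: doubleton_eq_iff)
            ultimately show ?thesis
              using True psubset.prems unfolding split by simp
          next
            case False
            then show ?thesis unfolding split by (auto intro!: sum.neutral)
          qed
        qed
        finally show "(\<Sum>i\<in>U. laplacian d E w i j) = 0" by simp
      qed (use psubset U in auto)
      ultimately show ?thesis by (simp only: sum.empty)
    qed
  qed
qed

section \<open>Spanning trees as rooted forests\<close>

lemma adjacency_sym: "(x, y) \<in> (adjacency G)\<^sup>* \<Longrightarrow> (y, x) \<in> (adjacency G)\<^sup>*"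
proof -
  have "sym (adjacency G)"
    by (auto simp: sym_def adjacency_def insert_commute)
  then show "(x, y) \<in> (adjacency G)\<^sup>* \<Longrightarrow> (y, x) \<in> (adjacency G)\<^sup>*"
    by (meson sym_rtrancl symD)
qed

lemma connected_graph_iff_grounded:
  assumes "graph G" "a \<in> verts G"
  shows "connected_graph G \<longleftrightarrow> (\<forall>x\<in>verts G - {a}. grounded (ends G) (edges G) (verts G - {a}) x)"
proof
  assume conn: "connected_graph G"
  show "\<forall>x\<in>verts G - {a}. grounded (ends G) (edges G) (verts G - {a}) x"
  proof
    fix x assume "x \<in> verts G - {a}"
    then have "(x, a) \<in> (adjacency G)\<^sup>*"
      using conn assms by (auto simp: connected_graph_def)
    then show "grounded (ends G) (edges G) (verts G - {a}) x"
    proof (induction rule: converse_rtrancl_induct)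
      case base
      show ?case by (rule grounded.base) simp
    next
      case (step x y)
      then obtain e where "e \<in> edges G" "ends G e = {x, y}"
        by (auto simp: adjacency_def)
      then show ?case using step.IH by (rule grounded.step)
    qed
  qed
next
  assume g: "\<forall>x\<in>verts G - {a}. grounded (ends G) (edges G) (verts G - {a}) x"
  have "grounded (ends G) (edges G) (verts G - {a}) x \<Longrightarrow> x \<in> verts G \<Longrightarrow>
      (x, a) \<in> (adjacency G)\<^sup>*" for x
  proof (induction rule: grounded.induct)
    case (step e x y)
    then have "y \<in> verts G" "(x, y) \<in> adjacency G"
      using assms by (fastforce simp: graph_def adjacency_def)+
    then show ?case using step by (meson converse_rtrancl_into_rtrancl)
  qed auto
  then have "(x, a) \<in> (adjacency G)\<^sup>*" if "x \<in> verts G" for x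
    using g that by (cases "x = a") auto
  then show "connected_graph G"
    using assms unfolding connected_graph_def by (blast intro: rtrancl_trans adjacency_sym)
qed

text \<open>Reachability yields only a walk; the distinct vertices are what a cycle will
  need.\<close>

lemma ends_closed_path:
  assumes "(x, y) \<in> (adjacency G)\<^sup>*"
  shows "\<exists>vs es. vs \<noteq> [] \<and> hd vs = x \<and> last vs = y \<and> distinct vs \<and> length vs = Suc (length es) \<and>
    set es \<subseteq> edges G \<and> (\<forall>i<length es. ends G (es ! i) = {vs ! i, vs ! Suc i})"
  using assms
proof (induction rule: converse_rtrancl_induct)
  case base
  show ?case by (rule exI[of _ "[y]"], rule exI[of _ "[]"]) auto
next
  case (step x z)
  then obtain e where e: "e \<in> edges G" "ends G e = {x, z}"
    by (auto simp: adjacency_def)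
  obtain vs es where p: "vs \<noteq> []" "hd vs = z" "last vs = y" "distinct vs"
      "length vs = Suc (length es)" "set es \<subseteq> edges G"
      "\<forall>i<length es. ends G (es ! i) = {vs ! i, vs ! Suc i}"
    using step.IH by blast
  show ?case
  proof (cases "x \<in> set vs")
    \<comment> \<open>A path that already visits \<open>x\<close> is cut off in front of
      \<open>x\<close>; the new edge is then not added.\<close>
    case True
    then obtain k where k: "k < length vs" "vs ! k = x"
      by (auto simp: in_set_conv_nth)
    show ?thesis
      using p k
      by (intro exI[of _ "drop k vs"] exI[of _ "drop k es"])
        (auto simp: hd_drop_conv_nth last_drop dest: in_set_dropD)
  next
    case False
    have "ends G ((e # es) ! i) = {(x # vs) ! i, (x # vs) ! Suc i}" if "i < length (e # es)" for i
      using that p e by (cases i) (auto simp: hd_conv_nth)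
    then show ?thesis
      using p e False by (intro exI[of _ "x # vs"] exI[of _ "e # es"]) auto
  qed
qed

text \<open>The edge \<open>e\<close> closes a path in \<open>S\<close> between its two ends. If
  that path is a single edge parallel to \<open>e\<close>, the cycle has length 2.\<close>

lemma cycle_of_extra_edge:
  assumes "graph G" "S \<subseteq> edges G" "connected_graph (spanning_subgraph G S)" "e \<in> edges G - S"
  shows "\<exists>vs es. is_cycle G vs es"
proof -
  obtain x y where xy: "ends G e = {x, y}" "x \<noteq> y" "x \<in> verts G" "y \<in> verts G"
  proof -
    have "card (ends G e) = 2" "ends G e \<subseteq> verts G"
      using assms by (auto simp: graph_def)
    then show ?thesis using that by (auto simp: card_2_iff)
  qed
  then have "(x, y) \<in> (adjacency (spanning_subgraph G S))\<^sup>*"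
    using assms by (auto simp: connected_graph_def spanning_subgraph_def)
  from ends_closed_path[OF this] obtain vs es where p: "vs \<noteq> []" "hd vs = x" "last vs = y"
      "distinct vs" "length vs = Suc (length es)" "set es \<subseteq> S"
      "\<forall>i<length es. ends G (es ! i) = {vs ! i, vs ! Suc i}"
    by (auto simp: spanning_subgraph_def)
  \<comment> \<open>Equal edges would have equal ends, and on a path with distinct vertices
    consecutive pairs at different positions are different sets.\<close>
  have "distinct es"
    unfolding distinct_conv_nth
  proof (intro allI impI)
    fix i j assume ij: "i < length es" "j < length es" "i \<noteq> j"
    show "es ! i \<noteq> es ! j"
    proof
      assume "es ! i = es ! j"
      then have "{vs ! i, vs ! Suc i} = {vs ! j, vs ! Suc j}"
        using p ij by metis
      then show False
        using p ij by (auto simp: doubleton_eq_iff nth_eq_iff_index_eq)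
    qed
  qed
  have "ends G ((es @ [e]) ! i) = {vs ! i, vs ! (Suc i mod length (es @ [e]))}"
    if "i < length (es @ [e])" for i
  proof (cases "i = length es")
    case True
    then have "vs ! i = y" "vs ! 0 = x"
      using p by (auto simp: last_conv_nth hd_conv_nth)
    then show ?thesis using True xy by (auto simp: insert_commute)
  next
    case False
    then show ?thesis using that p by (auto simp: nth_append)
  qed
  then have "is_cycle G vs (es @ [e])"
    using p assms \<open>distinct es\<close> by (auto simp: is_cycle_def)
  then show ?thesis by blast
qed

lemma connected_remove_cycle_edge:
  assumes "graph G" "connected_graph G" "is_cycle G vs es"
  shows "\<exists>e\<in>edges G. connected_graph (spanning_subgraph G (edges G - {e}))"
proof -
  \<comment> \<open>Removing the last edge, which returns to \<open>vs ! 0\<close>, leaves a path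
    whose indices never wrap around.\<close>
  let ?n = "length es - 1"
  let ?e = "es ! ?n"
  let ?A = "(adjacency (spanning_subgraph G (edges G - {?e})))\<^sup>*"
  have c: "es \<noteq> []" "length vs = length es" "distinct vs" "distinct es" "set es \<subseteq> edges G"
      "\<forall>i<length es. ends G (es ! i) = {vs ! i, vs ! (Suc i mod length es)}"
    using assms by (auto simp: is_cycle_def)
  then have n: "?n < length es" by (cases es) auto
  have e: "?e \<in> edges G" using c n nth_mem by blast
  have ends_e: "ends G ?e = {vs ! ?n, vs ! 0}"
    using c n by auto
  have "i \<le> ?n \<Longrightarrow> (vs ! 0, vs ! i) \<in> ?A" for i
  proof (induction i)
    case (Suc i)
    then have i: "Suc i < length es" using n by linarith
    then have "ends G (es ! i) = {vs ! i, vs ! Suc i}"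
      using c by auto
    moreover have "es ! i \<in> edges G - {?e}"
    proof -
      have "i < length es" "i \<noteq> ?n" using i by auto
      then have "es ! i \<noteq> ?e"
        using c(4) n by (simp add: nth_eq_iff_index_eq)
      moreover have "es ! i \<in> edges G"
        using c(5) i nth_mem[of i es] by auto
      ultimately show ?thesis by blast
    qed
    ultimately have "(vs ! i, vs ! Suc i) \<in> adjacency (spanning_subgraph G (edges G - {?e}))"
      by (auto simp: adjacency_def spanning_subgraph_def)
    then show ?case using Suc by (meson Suc_leD rtrancl_into_rtrancl)
  qed simp
  then have round: "(vs ! 0, vs ! ?n) \<in> ?A" by simp
  have "adjacency G \<subseteq> ?A"
  proof (rule subrelI)
    fix x y assume "(x, y) \<in> adjacency G"
    then obtain f where f: "f \<in> edges G" "ends G f = {x, y}" by (auto simp: adjacency_def)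
    show "(x, y) \<in> ?A"
    proof (cases "f = ?e")
      case True
      then have "x = vs ! 0 \<and> y = vs ! ?n \<or> x = vs ! ?n \<and> y = vs ! 0"
        using f ends_e by (auto simp: doubleton_eq_iff)
      then show ?thesis using round adjacency_sym[OF round] by auto
    next
      case False
      then have "(x, y) \<in> adjacency (spanning_subgraph G (edges G - {?e}))"
        using f by (auto simp: adjacency_def spanning_subgraph_def)
      then show ?thesis by auto
    qed
  qed
  then have "(adjacency G)\<^sup>* \<subseteq> ?A" by (rule rtrancl_subset_rtrancl)
  then have "connected_graph (spanning_subgraph G (edges G - {?e}))"
    using assms(2) by (auto simp: connected_graph_def spanning_subgraph_def)
  then show ?thesis using e by blast
qed

lemma graph_spanning_subgraph:
  "graph G \<Longrightarrow> T \<subseteq> edges G \<Longrightarrow> graph (spanning_subgraph G T)"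
  by (auto simp: graph_def spanning_subgraph_def intro: finite_subset)

text \<open>A tree contains a rooted forest \<open>S\<close> by \<open>grounded_forest\<close>;
  \<open>S\<close> already connects everything, so a further edge would close a cycle. Conversely, a
  cycle would allow deleting an edge while staying connected, leaving fewer edges than
  \<open>grounded_forest\<close> requires.\<close>

lemma is_tree_iff_rooted_forest:
  assumes G: "graph G" and a: "a \<in> verts G"
  shows "is_tree G \<longleftrightarrow> rooted_forest (ends G) (verts G - {a}) (edges G)"
proof
  have fin: "finite (edges G)" "finite (verts G - {a})"
    using G by (auto simp: graph_def)
  {
    assume tree: "is_tree G"
    then have g: "\<forall>x\<in>verts G - {a}. grounded (ends G) (edges G) (verts G - {a}) x"
      using connected_graph_iff_grounded[OF assms] by (simp add: is_tree_def)
    from grounded_forest[OF fin g] obtain S where S: "S \<subseteq> edges G"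
        "rooted_forest (ends G) (verts G - {a}) S" by blast
    have "graph (spanning_subgraph G S)"
      using G S by (intro graph_spanning_subgraph)
    then have "connected_graph (spanning_subgraph G S)"
      using connected_graph_iff_grounded[of "spanning_subgraph G S" a] S a
      by (auto simp: rooted_forest_def spanning_subgraph_def)
    then have "edges G - S = {}"
      using cycle_of_extra_edge[OF G S(1)] tree by (auto simp: is_tree_def)
    then show "rooted_forest (ends G) (verts G - {a}) (edges G)"
      using S by (simp add: subset_antisym)
  }
  {
    assume rf: "rooted_forest (ends G) (verts G - {a}) (edges G)"
    then have conn: "connected_graph G"
      using connected_graph_iff_grounded[OF assms] by (simp add: rooted_forest_def)
    have "\<not> is_cycle G vs es" for vs es
    proof
      assume "is_cycle G vs es"
      from connected_remove_cycle_edge[OF G conn this] obtain e where e: "e \<in> edges G"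
        "connected_graph (spanning_subgraph G (edges G - {e}))" by blast
      have "graph (spanning_subgraph G (edges G - {e}))"
        using G by (intro graph_spanning_subgraph) auto
      then have "\<forall>x\<in>verts G - {a}. grounded (ends G) (edges G - {e}) (verts G - {a}) x"
        using connected_graph_iff_grounded[of "spanning_subgraph G (edges G - {e})" a] e a
        by (auto simp: spanning_subgraph_def)
      then have "card (verts G - {a}) \<le> card (edges G - {e})"
        using grounded_forest[of "edges G - {e}" "verts G - {a}" "ends G"] fin by auto
      also have "\<dots> < card (edges G)"
        using e fin by (meson card_Diff1_less)
      finally show False using rf by (simp add: rooted_forest_def)
    qed
    then show "is_tree G" using conn by (simp add: is_tree_def)
  }
qed

section \<open>Weighted sums over spanning trees\<close>

definition tree_sum :: "('v, 'e) multigraph \<Rightarrow> ('e \<Rightarrow> real) \<Rightarrow> real" where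
  "tree_sum G w = (\<Sum>T | T \<subseteq> edges G \<and> is_tree (spanning_subgraph G T). \<Prod>e\<in>T. w e)"

lemma num_spanning_trees_eq_tree_sum: "real (num_spanning_trees G) = tree_sum G (\<lambda>_. 1)"
  by (simp add: num_spanning_trees_def tree_sum_def)

lemma spanning_tree_iff_rooted_forest:
  assumes "graph G" "a \<in> verts G" "T \<subseteq> edges G"
  shows "is_tree (spanning_subgraph G T) \<longleftrightarrow> rooted_forest (ends G) (verts G - {a}) T"
  using is_tree_iff_rooted_forest[OF graph_spanning_subgraph[OF assms(1,3)], of a] assms(2)
  by (simp add: spanning_subgraph_def)

lemma card_spanning_tree:
  assumes "graph G" "T \<subseteq> edges G" "is_tree (spanning_subgraph G T)"
  shows "Suc (card T) = card (verts G)"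
proof -
  obtain a where a: "a \<in> verts G"
    using assms by (auto simp: is_tree_def connected_graph_def spanning_subgraph_def)
  then have "card T = card (verts G - {a})"
    using spanning_tree_iff_rooted_forest[OF assms(1) a assms(2)] assms(3)
    by (simp add: rooted_forest_def)
  then show ?thesis
    using a assms(1) by (metis card_Suc_Diff1 graph_def)
qed

lemma tree_sum_eq_det:
  assumes "graph G" "a \<in> verts G"
  shows "tree_sum G w = set_det (verts G - {a}) (laplacian (ends G) (edges G) w)"
proof -
  have "{T. T \<subseteq> edges G \<and> is_tree (spanning_subgraph G T)} =
      {T. T \<subseteq> edges G \<and> rooted_forest (ends G) (verts G - {a}) T}"
    using spanning_tree_iff_rooted_forest[OF assms] by auto
  then show ?thesis
    unfolding tree_sum_def using assms
    by (simp add: matrix_tree graph_def)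
qed

section \<open>The incidence graph and the line graph\<close>

text \<open>As the graph is bipartite, its Laplacian has a diagonal block on each side, so either
  side can be eliminated by one use of \<open>set_det_schur\<close>.\<close>

definition incidence_graph :: "('v, 'e) multigraph \<Rightarrow> ('e + 'v, 'e \<times> 'v) multigraph" where
  "incidence_graph H =
     \<lparr>verts = Inl ` edges H \<union> Inr ` verts H,
      edges = Sigma (edges H) (ends H),
      ends = (\<lambda>(e, x). {Inl e, Inr x})\<rparr>"

lemma finite_ends: "graph G \<Longrightarrow> e \<in> edges G \<Longrightarrow> finite (ends G e)"
  by (rule card_ge_0_finite) (auto simp: graph_def)

lemma graph_incidence_graph: "graph H \<Longrightarrow> graph (incidence_graph H)"
  using finite_ends[of H] by (fastforce simp: graph_def incidence_graph_def)

lemma sum_incident_edges: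
  assumes "graph H"
  shows "(\<Sum>e\<in>edges H. \<Sum>y\<in>ends H e. if y = x then c else 0) = real (degree H x) * c"
proof -
  have "(\<Sum>e\<in>edges H. \<Sum>y\<in>ends H e. if y = x then c else 0) =
      (\<Sum>e\<in>edges H. if x \<in> ends H e then c else 0)"
    using finite_ends[OF assms] by (intro sum.cong refl) simp
  also have "\<dots> = (\<Sum>e | e \<in> edges H \<and> x \<in> ends H e. c)"
    using assms by (intro sum.mono_neutral_cong_right) (auto simp: graph_def)
  finally show ?thesis by (simp add: degree_def)
qed

lemma laplacian_incidence_graph:
  fixes c :: "'v \<Rightarrow> real"
  assumes H: "graph H"
  defines "L \<equiv> laplacian (ends (incidence_graph H)) (edges (incidence_graph H)) (\<lambda>(e, x). c x)"
  shows "e \<in> edges H \<Longrightarrow> L (Inl e) (Inl e) = (\<Sum>x\<in>ends H e. c x)"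
    and "e \<noteq> f \<Longrightarrow> L (Inl e) (Inl f) = 0"
    and "e \<in> edges H \<Longrightarrow> L (Inl e) (Inr x) = - (if x \<in> ends H e then c x else 0)"
    and "e \<in> edges H \<Longrightarrow> L (Inr x) (Inl e) = - (if x \<in> ends H e then c x else 0)"
    and "L (Inr x) (Inr x) = real (degree H x) * c x"
    and "x \<noteq> y \<Longrightarrow> L (Inr x) (Inr y) = 0"
proof -
  have fin: "finite (edges H)" "\<forall>e\<in>edges H. finite (ends H e)"
    using H finite_ends[OF H] by (auto simp: graph_def)
  have L: "L i j = (\<Sum>f\<in>edges H. \<Sum>y\<in>ends H f. c y *
      (if i = j then of_bool (i \<in> {Inl f, Inr y}) else - of_bool ({Inl f, Inr y} = {i, j})))" for i j
    unfolding L_def laplacian_def incidence_graph_def multigraph.simps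
    using sum.Sigma[OF fin, of "\<lambda>f y. c y * (if i = j then of_bool (i \<in> {Inl f, Inr y})
        else - of_bool ({Inl f, Inr y} = {i, j}))"]
    by (simp only: case_prod_unfold prod.collapse)
  {
    assume e: "e \<in> edges H"
    have "L (Inl e) (Inl e) = (\<Sum>f\<in>edges H. if f = e then \<Sum>x\<in>ends H e. c x else 0)"
      unfolding L by (intro sum.cong refl) auto
    then show "L (Inl e) (Inl e) = (\<Sum>x\<in>ends H e. c x)"
      using e fin by simp
    have "L (Inl e) (Inr x) =
        (\<Sum>f\<in>edges H. if f = e then \<Sum>y\<in>ends H e. if y = x then - c x else 0 else 0)"
      unfolding L by (intro sum.cong refl) (auto simp: doubleton_eq_iff intro!: sum.cong sum.neutral)
    then show *: "L (Inl e) (Inr x) = - (if x \<in> ends H e then c x else 0)"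
      using e fin by simp
    show "L (Inr x) (Inl e) = - (if x \<in> ends H e then c x else 0)"
      using * unfolding L_def by (subst laplacian_sym)
  }
  show "e \<noteq> f \<Longrightarrow> L (Inl e) (Inl f) = 0" "x \<noteq> y \<Longrightarrow> L (Inr x) (Inr y) = 0"
    unfolding L by (auto simp: doubleton_eq_iff intro!: sum.neutral)
  have "L (Inr x) (Inr x) = (\<Sum>e\<in>edges H. \<Sum>y\<in>ends H e. if y = x then c x else 0)"
    unfolding L by (intro sum.cong refl) auto
  then show "L (Inr x) (Inr x) = real (degree H x) * c x"
    by (simp add: sum_incident_edges[OF H])
qed

lemma graph_line_graph:
  assumes "graph H"
  shows "graph (line_graph H)"
proof -
  have "edges (line_graph H) \<subseteq> Pow (edges H) \<times> verts H"
    using assms by (fastforce simp: line_graph_def graph_def)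
  moreover have "finite (Pow (edges H) \<times> verts H)"
    using assms by (auto simp: graph_def)
  ultimately have "finite (edges (line_graph H))"
    by (rule finite_subset)
  then show ?thesis
    using assms by (auto simp: line_graph_def graph_def)
qed

lemma laplacian_line_graph:
  assumes H: "graph H" and "e \<in> edges H" "f \<in> edges H"
  defines "L \<equiv> laplacian (ends (line_graph H)) (edges (line_graph H)) (\<lambda>_. 1)"
  shows "L e e = (\<Sum>x\<in>ends H e. real (degree H x) - 1)"
    and "e \<noteq> f \<Longrightarrow> L e f = - real (card (ends H e \<inter> ends H f))"
proof -
  have fin: "finite (edges H)" "finite (ends H e)" "finite (edges (line_graph H))"
    using H finite_ends[OF H] assms(2) graph_line_graph[OF H] by (auto simp: graph_def)
  let ?S = "Sigma (ends H e) (\<lambda>x. {g \<in> edges H. x \<in> ends H g} - {e})"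
  have "L e e = real (card {g \<in> edges (line_graph H). e \<in> fst g})"
    unfolding L_def laplacian_def using fin by (simp add: line_graph_def Int_def)
  \<comment> \<open>An edge of the line graph at \<open>e\<close> is determined by the shared end
    \<open>x\<close> and the other edge \<open>g\<close> at \<open>x\<close>; two parallel edges are
    thus counted once for each end.\<close>
  also have "{g \<in> edges (line_graph H). e \<in> fst g} = (\<lambda>(x, g). ({e, g}, x)) ` ?S"
    using assms(2) by (force simp: line_graph_def image_iff insert_commute)
  also have "card \<dots> = card ?S"
    by (rule card_image) (auto simp: inj_on_def doubleton_eq_iff)
  also have "\<dots> = (\<Sum>x\<in>ends H e. card ({g \<in> edges H. x \<in> ends H g} - {e}))"
    using fin by simp
  also have "real \<dots> = (\<Sum>x\<in>ends H e. real (degree H x) - 1)"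
    unfolding of_nat_sum
  proof (intro sum.cong refl)
    fix x assume "x \<in> ends H e"
    then have "e \<in> {g \<in> edges H. x \<in> ends H g}" "finite {g \<in> edges H. x \<in> ends H g}"
      using assms(2) fin by auto
    then show "real (card ({g \<in> edges H. x \<in> ends H g} - {e})) = real (degree H x) - 1"
      using card_Suc_Diff1 by (fastforce simp: degree_def)
  qed
  finally show "L e e = (\<Sum>x\<in>ends H e. real (degree H x) - 1)" .
  assume ef: "e \<noteq> f"
  have "L e f = - real (card {g \<in> edges (line_graph H). fst g = {e, f}})"
    unfolding L_def laplacian_def using fin ef by (simp add: line_graph_def Int_def sum_negf)
  also have "{g \<in> edges (line_graph H). fst g = {e, f}} = Pair {e, f} ` (ends H e \<inter> ends H f)"
    using assms(2,3) ef by (force simp: line_graph_def doubleton_eq_iff)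
  also have "card \<dots> = card (ends H e \<inter> ends H f)"
    by (rule card_image) (auto simp: inj_on_def)
  finally show "L e f = - real (card (ends H e \<inter> ends H f))" .
qed

text \<open>Grounding at an edge \<open>a\<close> leaves all vertices of \<open>H\<close> to be
  eliminated. The pivot at \<open>x\<close> is the number d(x) of incidences times their weight
  d(x).\<close>

lemma num_spanning_trees_line_graph_incidence:
  fixes H :: "('v, 'e) multigraph"
  assumes H: "graph H" and ne: "edges H \<noteq> {}" and pos: "\<And>x. x \<in> verts H \<Longrightarrow> degree H x > 0"
  shows "tree_sum (incidence_graph H) (\<lambda>(e, x). real (degree H x)) =
    (\<Prod>x\<in>verts H. (real (degree H x))\<^sup>2) * real (num_spanning_trees (line_graph H))"
proof -
  obtain a where a: "a \<in> edges H" using ne by auto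
  let ?L = "laplacian (ends (incidence_graph H)) (edges (incidence_graph H))
    (\<lambda>(e, x). real (degree H x))"
  let ?U = "edges H - {a}"
  note lap = laplacian_incidence_graph[where c = "\<lambda>x. real (degree H x)", OF H]
  have fin: "finite (verts H)" "finite ?U" using H by (auto simp: graph_def)
  have "verts (incidence_graph H) - {Inl a} = Inr ` verts H \<union> Inl ` ?U"
    by (auto simp: incidence_graph_def)
  then have "tree_sum (incidence_graph H) (\<lambda>(e, x). real (degree H x)) =
      set_det (Inr ` verts H \<union> Inl ` ?U) ?L"
    using tree_sum_eq_det[OF graph_incidence_graph[OF H], of "Inl a"] a
    by (simp add: incidence_graph_def)
  also have "\<dots> = (\<Prod>z\<in>Inr ` verts H. ?L z z) *
      set_det (Inl ` ?U) (\<lambda>i j. ?L i j - (\<Sum>z\<in>Inr ` verts H. ?L i z * ?L z j / ?L z z))"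
  proof (rule set_det_schur)
    fix y z :: "'e + 'v" assume "y \<in> Inr ` verts H" "z \<in> Inr ` verts H" "y \<noteq> z"
    then show "?L y z = 0" using lap(6) by auto
  next
    fix z :: "'e + 'v" assume "z \<in> Inr ` verts H"
    then obtain x where "x \<in> verts H" "z = Inr x" by auto
    then show "?L z z \<noteq> 0" using pos[of x] by (simp add: lap(5))
  qed (use fin in auto)
  also have "(\<Prod>z\<in>Inr ` verts H. ?L z z) = (\<Prod>x\<in>verts H. (real (degree H x))\<^sup>2)"
    by (subst prod.reindex) (auto simp: lap(5) power2_eq_square)
  also have "set_det (Inl ` ?U) (\<lambda>i j. ?L i j - (\<Sum>z\<in>Inr ` verts H. ?L i z * ?L z j / ?L z z)) =
      set_det ?U (\<lambda>e f. ?L (Inl e) (Inl f) - (\<Sum>x\<in>verts H.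
        ?L (Inl e) (Inr x) * ?L (Inr x) (Inl f) / ?L (Inr x) (Inr x)))"
    using fin by (subst set_det_image) (auto simp: sum.reindex)
  also have "\<dots> = set_det ?U (laplacian (ends (line_graph H)) (edges (line_graph H)) (\<lambda>_. 1))"
  proof (rule set_det_cong)
    fix e f assume "e \<in> ?U" "f \<in> ?U"
    then have ef: "e \<in> edges H" "f \<in> edges H" by auto
    \<comment> \<open>At a common end the summand is d(x)*d(x) divided by the pivot d(x)*d(x), hence
      1; elsewhere it is 0. For \<open>e = f\<close> this lowers each d(x) on the diagonal to d(x) -
      1.\<close>
    have "(\<Sum>x\<in>verts H. ?L (Inl e) (Inr x) * ?L (Inr x) (Inl f) / ?L (Inr x) (Inr x)) =
        (\<Sum>x\<in>verts H. of_bool (x \<in> ends H e \<inter> ends H f))"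
      using ef by (intro sum.cong refl) (auto simp: lap(3-5) dest: pos)
    also have "\<dots> = real (card (verts H \<inter> (ends H e \<inter> ends H f)))"
      using fin by (simp add: Int_def)
    also have "verts H \<inter> (ends H e \<inter> ends H f) = ends H e \<inter> ends H f"
      using H ef by (auto simp: graph_def)
    finally have elim: "(\<Sum>x\<in>verts H. ?L (Inl e) (Inr x) * ?L (Inr x) (Inl f) / ?L (Inr x) (Inr x)) =
        real (card (ends H e \<inter> ends H f))" .
    show "?L (Inl e) (Inl f) - (\<Sum>x\<in>verts H.
        ?L (Inl e) (Inr x) * ?L (Inr x) (Inl f) / ?L (Inr x) (Inr x)) =
        laplacian (ends (line_graph H)) (edges (line_graph H)) (\<lambda>_. 1) e f"
      unfolding elim using ef
      by (cases "e = f") (simp_all add: lap(1,2) laplacian_line_graph[OF H] sum_subtractf)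
  qed
  also have "\<dots> = real (num_spanning_trees (line_graph H))"
    using tree_sum_eq_det[OF graph_line_graph[OF H], of a "\<lambda>_. 1"] a
    by (simp add: num_spanning_trees_eq_tree_sum line_graph_def)
  finally show ?thesis .
qed

text \<open>Grounding at a vertex \<open>a\<close> leaves the edges of \<open>H\<close> to be
  eliminated. Each of them is the midpoint of two conductances in series, whose product over sum is
  the new weight.\<close>

lemma tree_sum_incidence_graph:
  fixes H :: "('v, 'e) multigraph" and c :: "'v \<Rightarrow> real"
  assumes H: "graph H" and ne: "verts H \<noteq> {}" and pos: "\<And>x. x \<in> verts H \<Longrightarrow> c x > 0"
  shows "tree_sum (incidence_graph H) (\<lambda>(e, x). c x) =
    (\<Prod>e\<in>edges H. \<Sum>x\<in>ends H e. c x) *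
    tree_sum H (\<lambda>e. (\<Prod>x\<in>ends H e. c x) / (\<Sum>x\<in>ends H e. c x))"
proof -
  obtain a where a: "a \<in> verts H" using ne by auto
  let ?L = "laplacian (ends (incidence_graph H)) (edges (incidence_graph H)) (\<lambda>(e, x). c x)"
  let ?U = "verts H - {a}"
  let ?s = "\<lambda>e. \<Sum>x\<in>ends H e. c x"
  let ?p = "\<lambda>e. \<Prod>x\<in>ends H e. c x"
  note lap = laplacian_incidence_graph[where c = c, OF H]
  have fin: "finite (edges H)" "finite ?U" using H by (auto simp: graph_def)
  have s_pos: "?s e > 0" if e: "e \<in> edges H" for e
  proof (rule sum_pos)
    show "finite (ends H e)" using finite_ends[OF H e] .
    have "card (ends H e) = 2" using H e by (auto simp: graph_def)
    then show "ends H e \<noteq> {}" by auto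
    show "\<And>x. x \<in> ends H e \<Longrightarrow> c x > 0" using H e pos by (auto simp: graph_def)
  qed
  have "verts (incidence_graph H) - {Inr a} = Inl ` edges H \<union> Inr ` ?U"
    by (auto simp: incidence_graph_def)
  then have "tree_sum (incidence_graph H) (\<lambda>(e, x). c x) = set_det (Inl ` edges H \<union> Inr ` ?U) ?L"
    using tree_sum_eq_det[OF graph_incidence_graph[OF H], of "Inr a"] a
    by (simp add: incidence_graph_def)
  also have "\<dots> = (\<Prod>z\<in>Inl ` edges H. ?L z z) *
      set_det (Inr ` ?U) (\<lambda>i j. ?L i j - (\<Sum>z\<in>Inl ` edges H. ?L i z * ?L z j / ?L z z))"
  proof (rule set_det_schur)
    fix z :: "'e + 'v" assume "z \<in> Inl ` edges H"
    then obtain e where "e \<in> edges H" "z = Inl e" by auto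
    then show "?L z z \<noteq> 0" using s_pos[of e] by (simp add: lap(1))
  next
    fix y z :: "'e + 'v" assume "y \<in> Inl ` edges H" "z \<in> Inl ` edges H" "y \<noteq> z"
    then show "?L y z = 0" using lap(2) by auto
  qed (use fin in auto)
  also have "(\<Prod>z\<in>Inl ` edges H. ?L z z) = (\<Prod>e\<in>edges H. ?s e)"
    by (subst prod.reindex) (auto simp: lap(1) intro!: prod.cong)
  also have "set_det (Inr ` ?U) (\<lambda>i j. ?L i j - (\<Sum>z\<in>Inl ` edges H. ?L i z * ?L z j / ?L z z)) =
      set_det ?U (\<lambda>x y. ?L (Inr x) (Inr y) - (\<Sum>e\<in>edges H.
        ?L (Inr x) (Inl e) * ?L (Inl e) (Inr y) / ?L (Inl e) (Inl e)))"
    using fin by (subst set_det_image) (auto simp: sum.reindex)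
  also have "\<dots> = set_det ?U (laplacian (ends H) (edges H) (\<lambda>e. ?p e / ?s e))"
  proof (rule set_det_cong)
    fix x y assume xy: "x \<in> ?U" "y \<in> ?U"
    \<comment> \<open>The diagonal entry is spread over the edges at \<open>x\<close>, so that the
      difference with the correction can be evaluated one edge at a time.\<close>
    have diag: "?L (Inr x) (Inr y) = (\<Sum>e\<in>edges H. if x = y \<and> x \<in> ends H e then c x else 0)"
    proof (cases "x = y")
      case True
      have "(\<Sum>e\<in>edges H. \<Sum>y\<in>ends H e. if y = x then c x else 0) =
          (\<Sum>e\<in>edges H. if x \<in> ends H e then c x else 0)"
        using finite_ends[OF H] by (intro sum.cong refl) simp
      then show ?thesis using True by (simp add: lap(5) sum_incident_edges[OF H])
    qed (simp add: lap(6))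
    have "(if x = y \<and> x \<in> ends H e then c x else 0) -
        ?L (Inr x) (Inl e) * ?L (Inl e) (Inr y) / ?L (Inl e) (Inl e) =
        ?p e / ?s e * (if x = y then of_bool (x \<in> ends H e) else - of_bool (ends H e = {x, y}))"
      if e: "e \<in> edges H" for e
    proof -
      obtain k l where kl: "ends H e = {k, l}" "k \<noteq> l"
        using H e by (auto simp: graph_def card_2_iff)
      then have "c k + c l \<noteq> 0" using s_pos[OF e] by simp
      then show ?thesis
        using e kl by (auto simp: lap(1,3,4) field_simps doubleton_eq_iff)
    qed
    then show "?L (Inr x) (Inr y) - (\<Sum>e\<in>edges H.
        ?L (Inr x) (Inl e) * ?L (Inl e) (Inr y) / ?L (Inl e) (Inl e)) =
        laplacian (ends H) (edges H) (\<lambda>e. ?p e / ?s e) x y"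
      unfolding diag laplacian_def[of "ends H"] sum_subtractf[symmetric] by (rule sum.cong[OF refl])
  qed
  also have "\<dots> = tree_sum H (\<lambda>e. ?p e / ?s e)"
    using tree_sum_eq_det[OF H a] by simp
  finally show ?thesis .
qed

section \<open>Spanning trees of the line graph in terms of edge resistances\<close>

lemma prod_ends:
  fixes c :: "'v \<Rightarrow> real"
  assumes "graph H"
  shows "(\<Prod>e\<in>edges H. \<Prod>x\<in>ends H e. c x) = (\<Prod>x\<in>verts H. c x ^ degree H x)"
proof -
  have fin: "finite (verts H)" "finite (edges H)" using assms by (auto simp: graph_def)
  have "(\<Prod>e\<in>edges H. \<Prod>x\<in>ends H e. c x) =
      (\<Prod>e\<in>edges H. \<Prod>x\<in>verts H. if x \<in> ends H e then c x else 1)"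
    using assms fin by (intro prod.cong refl prod.mono_neutral_cong_left) (auto simp: graph_def)
  also have "\<dots> = (\<Prod>x\<in>verts H. \<Prod>e\<in>edges H. if x \<in> ends H e then c x else 1)"
    by (rule prod.swap)
  also have "\<dots> = (\<Prod>x\<in>verts H. \<Prod>e | e \<in> edges H \<and> x \<in> ends H e. c x)"
    using fin by (intro prod.cong refl prod.mono_neutral_cong_right) auto
  finally show ?thesis by (simp add: degree_def)
qed

text \<open>The two evaluations of the incidence graph are equated and the squared degrees
  cancelled. The integer power is needed since a vertex of degree 1 gets the exponent -1.\<close>

lemma num_spanning_trees_line_graph:
  fixes H :: "('v, 'e) multigraph"
  assumes H: "graph H" and ne: "edges H \<noteq> {}" and pos: "\<And>x. x \<in> verts H \<Longrightarrow> degree H x > 0"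
  defines "R \<equiv> \<lambda>e. \<Sum>x\<in>ends H e. inverse (real (degree H x))"
  shows "real (num_spanning_trees (line_graph H)) =
    (\<Prod>x\<in>verts H. real (degree H x) powi (int (degree H x) - 2)) *
    ((\<Prod>e\<in>edges H. R e) * tree_sum H (\<lambda>e. inverse (R e)))"
proof -
  let ?d = "\<lambda>x. real (degree H x)"
  let ?s = "\<lambda>e. \<Sum>x\<in>ends H e. ?d x"
  let ?p = "\<lambda>e. \<Prod>x\<in>ends H e. ?d x"
  have sp: "?s e = ?p e * R e \<and> ?p e / ?s e = inverse (R e)" if e: "e \<in> edges H" for e
  proof -
    obtain k l where kl: "ends H e = {k, l}" "k \<noteq> l" "k \<in> verts H" "l \<in> verts H"
      using H e by (fastforce simp: graph_def card_2_iff)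
    then have "?d k > 0" "?d l > 0" using pos by auto
    then have "?d k \<noteq> 0" "?d l \<noteq> 0" "?d k + ?d l \<noteq> 0" by linarith+
    then show ?thesis unfolding R_def using kl by (simp add: field_simps)
  qed
  have "verts H \<noteq> {}"
    using H ne by (fastforce simp: graph_def card_2_iff)
  then have "(\<Prod>x\<in>verts H. (?d x)\<^sup>2) * real (num_spanning_trees (line_graph H)) =
      (\<Prod>e\<in>edges H. ?s e) * tree_sum H (\<lambda>e. ?p e / ?s e)"
    using num_spanning_trees_line_graph_incidence[OF H ne pos] tree_sum_incidence_graph[OF H, of ?d] pos
    by simp
  also have "tree_sum H (\<lambda>e. ?p e / ?s e) = tree_sum H (\<lambda>e. inverse (R e))"
    unfolding tree_sum_def using sp by (intro sum.cong refl prod.cong) auto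
  also have "(\<Prod>e\<in>edges H. ?s e) = (\<Prod>e\<in>edges H. ?p e) * (\<Prod>e\<in>edges H. R e)"
    using sp by (simp add: prod.distrib[symmetric])
  also have "(\<Prod>e\<in>edges H. ?p e) = (\<Prod>x\<in>verts H. ?d x ^ degree H x)"
    by (rule prod_ends[OF H])
  also have "\<dots> = (\<Prod>x\<in>verts H. (?d x)\<^sup>2) * (\<Prod>x\<in>verts H. ?d x powi (int (degree H x) - 2))"
    unfolding prod.distrib[symmetric]
    using pos by (intro prod.cong refl) (simp add: power_int_diff power2_eq_square)
  finally have "(\<Prod>x\<in>verts H. (?d x)\<^sup>2) * real (num_spanning_trees (line_graph H)) =
      (\<Prod>x\<in>verts H. (?d x)\<^sup>2) * ((\<Prod>x\<in>verts H. ?d x powi (int (degree H x) - 2)) *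
        ((\<Prod>e\<in>edges H. R e) * tree_sum H (\<lambda>e. inverse (R e))))"
    by (simp add: mult_ac)
  moreover have "(\<Prod>x\<in>verts H. (?d x)\<^sup>2) \<noteq> 0"
    using H pos by (auto simp: graph_def)
  ultimately show ?thesis
    by (simp only: mult_cancel_left) simp
qed

section \<open>Subdivisions\<close>

lemma graph_subdivision:
  assumes G: "graph G" and uv: "\<And>e. e \<in> edges G \<Longrightarrow> ends G e = {u e, v e}"
  shows "graph (subdivision r u v G)"
proof -
  have "u e \<in> verts G \<and> v e \<in> verts G \<and> u e \<noteq> v e" if "e \<in> edges G" for e
    using G uv[OF that] that by (fastforce simp: graph_def card_2_iff doubleton_eq_iff)
  then show ?thesis
    using G by (auto simp: graph_def subdivision_def path_vertex_def card_insert_if)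
qed

lemma degree_subdivision_Inl:
  assumes G: "graph G" and uv: "\<And>e. e \<in> edges G \<Longrightarrow> ends G e = {u e, v e}"
  shows "degree (subdivision r u v G) (Inl x) = degree G x"
proof -
  have ne: "u e \<noteq> v e" if "e \<in> edges G" for e
    using G uv[OF that] that by (fastforce simp: graph_def card_2_iff doubleton_eq_iff)
  \<comment> \<open>An edge \<open>e\<close> at \<open>x\<close> contributes its first segment if
    \<open>x = u e\<close> and its last one if \<open>x = v e\<close>; for \<open>r = 0\<close> the
    two coincide.\<close>
  have "{f \<in> edges (subdivision r u v G). Inl x \<in> ends (subdivision r u v G) f} =
      (\<lambda>e. (e, if x = u e then 0 else r)) ` {e \<in> edges G. x \<in> ends G e}"
    using uv by (auto simp: subdivision_def path_vertex_def image_iff dest: ne ne[THEN not_sym] split: if_splits)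
  moreover have "inj_on (\<lambda>e. (e, if x = u e then 0 else r)) {e \<in> edges G. x \<in> ends G e}"
    by (auto simp: inj_on_def)
  ultimately show ?thesis
    by (simp add: degree_def card_image)
qed

lemma degree_subdivision_Inr:
  assumes "e \<in> edges G" "1 \<le> i" "i \<le> r"
  shows "degree (subdivision r u v G) (Inr (e, i)) = 2"
proof -
  have "{f \<in> edges (subdivision r u v G). Inr (e, i) \<in> ends (subdivision r u v G) f} =
      {(e, i - 1), (e, i)}"
    using assms by (auto simp: subdivision_def path_vertex_def split: if_splits)
  then show ?thesis using assms by (simp add: degree_def)
qed

text \<open>The graph with \<open>r = 0\<close> is only a relabelled copy of \<open>G\<close>;
  comparing minors transfers the tree sum without an isomorphism argument for trees.\<close>

lemma tree_sum_subdivision_0: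
  assumes G: "graph G" and ne: "verts G \<noteq> {}"
    and uv: "\<And>e. e \<in> edges G \<Longrightarrow> ends G e = {u e, v e}"
  shows "tree_sum (subdivision 0 u v G) w = tree_sum G (\<lambda>e. w (e, 0))"
proof -
  obtain a where a: "a \<in> verts G" using ne by auto
  let ?S = "subdivision 0 u v G"
  have S: "edges ?S = (\<lambda>e. (e, 0)) ` edges G" "ends ?S (e, 0) = {Inl (u e), Inl (v e)}" for e
    by (auto simp: subdivision_def path_vertex_def)
  have "tree_sum ?S w = set_det (verts ?S - {Inl a}) (laplacian (ends ?S) (edges ?S) w)"
    using a by (intro tree_sum_eq_det graph_subdivision G uv) (auto simp: subdivision_def)
  also have "verts ?S - {Inl a} = Inl ` (verts G - {a})"
    by (auto simp: subdivision_def)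
  also have "set_det \<dots> (laplacian (ends ?S) (edges ?S) w) =
      set_det (verts G - {a}) (\<lambda>i j. laplacian (ends ?S) (edges ?S) w (Inl i) (Inl j))"
    using G by (intro set_det_image) (auto simp: graph_def)
  also have "(\<lambda>i j. laplacian (ends ?S) (edges ?S) w (Inl i) (Inl j)) =
      laplacian (ends G) (edges G) (\<lambda>e. w (e, 0))"
    unfolding laplacian_def S(1)
    by (subst sum.reindex) (auto simp: inj_on_def fun_eq_iff S(2) uv doubleton_eq_iff intro!: sum.cong)
  also have "set_det (verts G - {a}) \<dots> = tree_sum G (\<lambda>e. w (e, 0))"
    using tree_sum_eq_det[OF G a] by simp
  finally show ?thesis .
qed

text \<open>The last inner vertex of every path is eliminated, all in one Schur step since no two of
  them are adjacent. The product collects the pivots, and the last two segments merge in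
  series.\<close>

lemma tree_sum_subdivision_Suc:
  fixes G :: "('v, 'e) multigraph"
  assumes G: "graph G" and ne: "verts G \<noteq> {}"
    and uv: "\<And>e. e \<in> edges G \<Longrightarrow> ends G e = {u e, v e}"
    and pos: "\<And>e k. e \<in> edges G \<Longrightarrow> k \<le> Suc r \<Longrightarrow> R (e, k) > 0"
  shows "tree_sum (subdivision (Suc r) u v G) (\<lambda>f. inverse (R f)) =
    (\<Prod>e\<in>edges G. inverse (R (e, r)) + inverse (R (e, Suc r))) *
    tree_sum (subdivision r u v G)
      (\<lambda>(e, k). inverse (if k = r then R (e, r) + R (e, Suc r) else R (e, k)))"
proof -
  obtain a where a: "a \<in> verts G" using ne by auto
  let ?S = "subdivision (Suc r) u v G"
  let ?S' = "subdivision r u v G"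
  let ?U = "verts ?S' - {Inl a}"
  let ?R' = "\<lambda>(e, k). inverse (if k = r then R (e, r) + R (e, Suc r) else R (e, k))"
  define w where "w f = inverse (R f)" for f
  \<comment> \<open>\<open>z e\<close> is the vertex to be eliminated. The vertices
    \<open>p e k\<close> of the shorter path agree with those of the longer one up to
    \<open>k = r\<close>; at \<open>Suc r\<close> the shorter path is already at \<open>v e\<close>,
    the longer one at \<open>z e\<close>.\<close>
  define z :: "'e \<Rightarrow> 'v + 'e \<times> nat" where "z e = Inr (e, Suc r)" for e
  define p where "p e = path_vertex r u v e" for e
  \<comment> \<open>\<open>F P\<close> is the Laplacian of a single edge with set of ends
    \<open>P\<close> and weight 1.\<close>
  define F :: "('v + 'e \<times> nat) set \<Rightarrow> 'v + 'e \<times> nat \<Rightarrow> 'v + 'e \<times> nat \<Rightarrow> real" where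
    "F P i j = (if i = j then of_bool (i \<in> P) else - of_bool (P = {i, j}))" for P i j
  let ?L = "laplacian (ends ?S) (edges ?S) w"
  have fin: "finite (edges G)" "finite ?U"
    using G graph_subdivision[OF G uv] by (auto simp: graph_def)
  have u_ne_v: "u e \<noteq> v e" if "e \<in> edges G" for e
    using G uv[OF that] that by (fastforce simp: graph_def card_2_iff doubleton_eq_iff)
  have p_ne: "p e k \<noteq> z f" "z f \<noteq> p e k" if "k \<le> Suc r" for e f k
    using that by (auto simp: p_def z_def path_vertex_def)
  have p_v: "p e (Suc r) = Inl (v e)" and v_ne: "Inl (v e) \<noteq> z f" for e f
    by (auto simp: p_def z_def path_vertex_def)
  have p_r: "p e r \<noteq> Inl (v e)" if "e \<in> edges G" for e
    using u_ne_v[OF that] by (auto simp: p_def path_vertex_def)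
  have q: "path_vertex (Suc r) u v e k = p e k" if "k \<le> r" for e k
    using that by (auto simp: p_def path_vertex_def)
  have q': "path_vertex (Suc r) u v e (Suc r) = z e"
      "path_vertex (Suc r) u v e (Suc (Suc r)) = Inl (v e)" for e
    by (auto simp: z_def path_vertex_def)
  have inj_z: "inj_on z A" for A
    by (auto simp: inj_on_def z_def)
  have L: "?L i j = (\<Sum>e\<in>edges G. (\<Sum>k<r. w (e, k) * F {p e k, p e (Suc k)} i j) +
      w (e, r) * F {p e r, z e} i j + w (e, Suc r) * F {z e, Inl (v e)} i j)" for i j
  proof -
    have "?L i j = (\<Sum>e\<in>edges G. \<Sum>k\<in>{0..Suc r}. w (e, k) *
        F {path_vertex (Suc r) u v e k, path_vertex (Suc r) u v e (Suc k)} i j)"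
      by (simp add: laplacian_def F_def subdivision_def sum.cartesian_product case_prod_unfold
          del: sum.cl_ivl_Suc)
    also have "\<dots> = (\<Sum>e\<in>edges G. (\<Sum>k<r. w (e, k) * F {p e k, p e (Suc k)} i j) +
        w (e, r) * F {p e r, z e} i j + w (e, Suc r) * F {z e, Inl (v e)} i j)"
    proof (intro sum.cong refl)
      fix e
      have "{0..Suc r} = insert (Suc r) (insert r {..<r})" by auto
      then show "(\<Sum>k\<in>{0..Suc r}. w (e, k) *
          F {path_vertex (Suc r) u v e k, path_vertex (Suc r) u v e (Suc k)} i j) =
          (\<Sum>k<r. w (e, k) * F {p e k, p e (Suc k)} i j) +
          w (e, r) * F {p e r, z e} i j + w (e, Suc r) * F {z e, Inl (v e)} i j"
        by (simp add: q q')
    qed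
    finally show ?thesis .
  qed
  have L': "laplacian (ends ?S') (edges ?S') ?R' i j =
      (\<Sum>e\<in>edges G. (\<Sum>k<r. w (e, k) * F {p e k, p e (Suc k)} i j) +
        inverse (R (e, r) + R (e, Suc r)) * F {p e r, Inl (v e)} i j)" for i j
  proof -
    have "laplacian (ends ?S') (edges ?S') ?R' i j =
        (\<Sum>e\<in>edges G. \<Sum>k\<in>{0..r}.
          inverse (if k = r then R (e, r) + R (e, Suc r) else R (e, k)) * F {p e k, p e (Suc k)} i j)"
      by (simp add: laplacian_def F_def p_def subdivision_def sum.cartesian_product case_prod_unfold)
    also have "\<dots> = (\<Sum>e\<in>edges G. (\<Sum>k<r. w (e, k) * F {p e k, p e (Suc k)} i j) +
        inverse (R (e, r) + R (e, Suc r)) * F {p e r, Inl (v e)} i j)"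
    proof (intro sum.cong refl)
      fix e
      have "{0..r} = insert r {..<r}" by auto
      then show "(\<Sum>k\<in>{0..r}.
          inverse (if k = r then R (e, r) + R (e, Suc r) else R (e, k)) * F {p e k, p e (Suc k)} i j) =
          (\<Sum>k<r. w (e, k) * F {p e k, p e (Suc k)} i j) +
          inverse (R (e, r) + R (e, Suc r)) * F {p e r, Inl (v e)} i j"
        by (simp add: w_def p_v)
    qed
    finally show ?thesis .
  qed
  have Lzz: "?L (z e) (z e) = w (e, r) + w (e, Suc r)" if "e \<in> edges G" for e
  proof -
    have "?L (z e) (z e) = (\<Sum>f\<in>edges G. if f = e then w (e, r) + w (e, Suc r) else 0)"
      unfolding L
    proof (intro sum.cong refl)
      fix f
      have "(\<Sum>k<r. w (f, k) * F {p f k, p f (Suc k)} (z e) (z e)) = 0"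
        by (intro sum.neutral) (auto simp: F_def p_ne)
      then show "(\<Sum>k<r. w (f, k) * F {p f k, p f (Suc k)} (z e) (z e)) +
          w (f, r) * F {p f r, z f} (z e) (z e) + w (f, Suc r) * F {z f, Inl (v f)} (z e) (z e) =
          (if f = e then w (e, r) + w (e, Suc r) else 0)"
        using p_ne[of r f e] by (auto simp: F_def z_def)
    qed
    then show ?thesis using that fin by simp
  qed
  have Liz: "?L i (z e) = - (if i = p e r then w (e, r) else 0) - (if i = Inl (v e) then w (e, Suc r) else 0)"
    if "e \<in> edges G" "i \<noteq> z e" for i e
  proof -
    have "?L i (z e) = (\<Sum>f\<in>edges G. if f = e then
        - (if i = p e r then w (e, r) else 0) - (if i = Inl (v e) then w (e, Suc r) else 0) else 0)"
      unfolding L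
    proof (intro sum.cong refl)
      fix f
      have "(\<Sum>k<r. w (f, k) * F {p f k, p f (Suc k)} i (z e)) = 0"
        using that(2) by (intro sum.neutral) (auto simp: F_def doubleton_eq_iff p_ne)
      then show "(\<Sum>k<r. w (f, k) * F {p f k, p f (Suc k)} i (z e)) +
          w (f, r) * F {p f r, z f} i (z e) + w (f, Suc r) * F {z f, Inl (v f)} i (z e) =
          (if f = e then - (if i = p e r then w (e, r) else 0) -
            (if i = Inl (v e) then w (e, Suc r) else 0) else 0)"
        using p_ne[of r f e] that(2) by (auto simp: F_def z_def doubleton_eq_iff)
    qed
    then show ?thesis using that fin by simp
  qed
  have Lzy: "?L (z e) (z f) = 0" if "e \<noteq> f" "f \<in> edges G" for e f
    using Liz[of f "z e"] that p_ne[of r f e] by (auto simp: z_def)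
  have "verts ?S - {Inl a} = z ` edges G \<union> ?U"
    by (auto simp: subdivision_def z_def image_iff not_less_eq_eq)
  then have "tree_sum ?S w = set_det (z ` edges G \<union> ?U) ?L"
    using tree_sum_eq_det[OF graph_subdivision[OF G uv], of "Inl a"] a
    by (simp add: subdivision_def)
  also have "\<dots> = (\<Prod>y\<in>z ` edges G. ?L y y) *
      set_det ?U (\<lambda>i j. ?L i j - (\<Sum>y\<in>z ` edges G. ?L i y * ?L y j / ?L y y))"
  proof (rule set_det_schur)
    show "z ` edges G \<inter> ?U = {}"
      by (auto simp: subdivision_def z_def)
    fix y assume "y \<in> z ` edges G"
    then obtain e where e: "e \<in> edges G" "y = z e" by auto
    then show "?L y y \<noteq> 0"
      using pos[of e r] pos[of e "Suc r"] by (simp add: Lzz w_def add_pos_pos less_imp_neq[symmetric])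
  next
    fix x y assume "x \<in> z ` edges G" "y \<in> z ` edges G" "x \<noteq> y"
    then show "?L x y = 0" by (metis Lzy imageE)
  qed (use fin in auto)
  also have "(\<Prod>y\<in>z ` edges G. ?L y y) = (\<Prod>e\<in>edges G. w (e, r) + w (e, Suc r))"
    by (subst prod.reindex[OF inj_z]) (auto simp: Lzz intro!: prod.cong)
  also have "set_det ?U (\<lambda>i j. ?L i j - (\<Sum>y\<in>z ` edges G. ?L i y * ?L y j / ?L y y)) =
      set_det ?U (laplacian (ends ?S') (edges ?S') ?R')"
  proof (rule set_det_cong)
    fix i j assume "i \<in> ?U" "j \<in> ?U"
    then have iz: "i \<noteq> z e" and jz: "j \<noteq> z e" for e
      by (auto simp: subdivision_def z_def)
    \<comment> \<open>With conductances A and B at \<open>z e\<close>, the correction turns the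
      diagonal entries into A - A*A/(A+B) and B - B*B/(A+B) and creates the off-diagonal entry
      -A*B/(A+B). All three have absolute value A*B/(A+B), the series conductance.\<close>
    have series: "w (e, r) * F {p e r, z e} i j + w (e, Suc r) * F {z e, Inl (v e)} i j -
        ?L i (z e) * ?L (z e) j / ?L (z e) (z e) =
        inverse (R (e, r) + R (e, Suc r)) * F {p e r, Inl (v e)} i j" if e: "e \<in> edges G" for e
    proof -
      have Lzj: "?L (z e) j = ?L j (z e)" by (rule laplacian_sym)
      let ?A = "w (e, r)" and ?B = "w (e, Suc r)" and ?C = "inverse (R (e, r) + R (e, Suc r))"
      have "R (e, r) > 0" "R (e, Suc r) > 0" using pos e by auto
      then have R_ne: "R (e, r) \<noteq> 0" "R (e, Suc r) \<noteq> 0" "R (e, r) + R (e, Suc r) \<noteq> 0" by linarith+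
      then have "?A + ?B = (R (e, r) + R (e, Suc r)) / (R (e, r) * R (e, Suc r))"
        by (simp add: w_def field_simps)
      with R_ne have AB: "?A + ?B \<noteq> 0" "?A * ?B / (?A + ?B) = ?C"
        by (auto simp: w_def inverse_eq_divide)
      have AA: "?A - ?A * ?A / (?A + ?B) = ?C" and BB: "?B - ?B * ?B / (?A + ?B) = ?C"
        unfolding AB(2)[symmetric] using AB(1) by (simp_all add: field_simps)
      show ?thesis
        unfolding Lzj Lzz[OF e] Liz[OF e iz] Liz[OF e jz]
        using p_r[OF e] p_ne(1)[of r e e] v_ne[of e e] iz[of e] jz[of e]
        by (auto simp: F_def doubleton_eq_iff AA BB AB(2) mult.commute[of ?B ?A])
    qed
    have "?L i j - (\<Sum>y\<in>z ` edges G. ?L i y * ?L y j / ?L y y) =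
        ?L i j - (\<Sum>e\<in>edges G. ?L i (z e) * ?L (z e) j / ?L (z e) (z e))"
      by (simp add: sum.reindex[OF inj_z])
    also have "\<dots> = laplacian (ends ?S') (edges ?S') ?R' i j"
      unfolding L[of i j] L' sum_subtractf[symmetric]
      by (intro sum.cong refl) (use series in \<open>simp add: algebra_simps\<close>)
    finally show "?L i j - (\<Sum>y\<in>z ` edges G. ?L i y * ?L y j / ?L y y) =
        laplacian (ends ?S') (edges ?S') ?R' i j" .
  qed
  also have "\<dots> = tree_sum ?S' ?R'"
    using a by (intro tree_sum_eq_det[symmetric] graph_subdivision G uv) (auto simp: subdivision_def)
  finally show ?thesis by (simp add: w_def[abs_def])
qed

text \<open>The product of all resistances times the tree sum of conductances adds up, over the
  spanning trees, the resistances multiplied along the edges outside the tree. It is invariant under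
  series merging: the pivot 1/R + 1/R' turns the factor R*R' into R + R'.\<close>

lemma tree_sum_subdivision:
  assumes G: "graph G" and ne: "verts G \<noteq> {}"
    and uv: "\<And>e. e \<in> edges G \<Longrightarrow> ends G e = {u e, v e}"
    and pos: "\<And>e k. e \<in> edges G \<Longrightarrow> k \<le> r \<Longrightarrow> R (e, k) > 0"
  shows "(\<Prod>f\<in>edges (subdivision r u v G). R f) * tree_sum (subdivision r u v G) (\<lambda>f. inverse (R f)) =
    (\<Prod>e\<in>edges G. \<Sum>k\<le>r. R (e, k)) * tree_sum G (\<lambda>e. inverse (\<Sum>k\<le>r. R (e, k)))"
  using pos
proof (induction r arbitrary: R)
  case 0
  have "edges (subdivision 0 u v G) = (\<lambda>e. (e, 0)) ` edges G"
    by (auto simp: subdivision_def)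
  then have "(\<Prod>f\<in>edges (subdivision 0 u v G). R f) = (\<Prod>e\<in>edges G. R (e, 0))"
    by (simp add: prod.reindex inj_on_def)
  then show ?case by (simp add: tree_sum_subdivision_0[OF G ne uv])
next
  case (Suc r)
  define R' where "R' = (\<lambda>(e, k). if k = r then R (e, r) + R (e, Suc r) else R (e, k))"
  have pos': "R' (e, k) > 0" if "e \<in> edges G" "k \<le> r" for e k
    using Suc.prems that by (auto simp: R'_def add_pos_pos)
  have edges: "(\<Prod>f\<in>edges (subdivision m u v G). g f) = (\<Prod>e\<in>edges G. \<Prod>k\<le>m. g (e, k))"
    for m and g :: "'b \<times> nat \<Rightarrow> real"
    by (simp add: subdivision_def prod.cartesian_product atLeast0AtMost)
  have split: "{..r} = insert r {..<r}" by auto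
  have "(\<Prod>k\<le>Suc r. R (e, k)) * (inverse (R (e, r)) + inverse (R (e, Suc r))) = (\<Prod>k\<le>r. R' (e, k))"
    if "e \<in> edges G" for e
  proof -
    have "R (e, r) \<noteq> 0" "R (e, Suc r) \<noteq> 0"
      using Suc.prems[OF that, of r] Suc.prems[OF that, of "Suc r"] by auto
    then show ?thesis by (simp add: split R'_def field_simps)
  qed
  then have prod: "(\<Prod>f\<in>edges (subdivision (Suc r) u v G). R f) *
      (\<Prod>e\<in>edges G. inverse (R (e, r)) + inverse (R (e, Suc r))) =
      (\<Prod>f\<in>edges (subdivision r u v G). R' f)"
    unfolding edges prod.distrib[symmetric] by simp
  have sum: "(\<Sum>k\<le>r. R' (e, k)) = (\<Sum>k\<le>Suc r. R (e, k))" for e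
    by (simp add: split R'_def)
  have "(\<Prod>f\<in>edges (subdivision (Suc r) u v G). R f) *
      tree_sum (subdivision (Suc r) u v G) (\<lambda>f. inverse (R f)) =
      (\<Prod>f\<in>edges (subdivision r u v G). R' f) * tree_sum (subdivision r u v G) (\<lambda>f. inverse (R' f))"
    using tree_sum_subdivision_Suc[where r = r and R = R, OF G ne uv Suc.prems] prod[symmetric]
    by (simp add: R'_def case_prod_unfold mult_ac)
  also have "\<dots> = (\<Prod>e\<in>edges G. \<Sum>k\<le>r. R' (e, k)) * tree_sum G (\<lambda>e. inverse (\<Sum>k\<le>r. R' (e, k)))"
    by (rule Suc.IH) (rule pos')
  finally show ?case unfolding sum .
qed

section \<open>Resistance of a subdivided edge and expansion of the tree sum\<close>

lemma sum_resistances_subdivision: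
  assumes G: "graph G" and uv: "\<And>e. e \<in> edges G \<Longrightarrow> ends G e = {u e, v e}" and e: "e \<in> edges G"
  shows "(\<Sum>k\<le>r. \<Sum>x\<in>ends (subdivision r u v G) (e, k).
      inverse (real (degree (subdivision r u v G) x))) =
    real r + (inverse (real (degree G (u e))) + inverse (real (degree G (v e))))"
proof -
  let ?S = "subdivision r u v G"
  define h where "h k = inverse (real (degree ?S (path_vertex r u v e k)))" for k
  have h: "h 0 = inverse (real (degree G (u e)))" "h (Suc r) = inverse (real (degree G (v e)))"
    by (simp_all add: h_def path_vertex_def degree_subdivision_Inl[OF G uv])
  have h': "h (Suc k) = 1 / 2" if "k < r" for k
    using that e by (simp add: h_def path_vertex_def degree_subdivision_Inr)
  have "(\<Sum>x\<in>ends ?S (e, k). inverse (real (degree ?S x))) = h k + h (Suc k)" if "k \<le> r" for k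
  proof -
    have "card (ends ?S (e, k)) = 2"
      using graph_subdivision[OF G uv, of r] e that by (auto simp: graph_def subdivision_def)
    then have "path_vertex r u v e k \<noteq> path_vertex r u v e (Suc k)"
      by (auto simp: subdivision_def)
    then show ?thesis by (simp add: h_def subdivision_def)
  qed
  \<comment> \<open>Each of the \<open>r\<close> inner vertices lies on two segments and contributes
    1/2 to both, hence 1 in total; each end of the path is counted once.\<close>
  then have "(\<Sum>k\<le>r. \<Sum>x\<in>ends ?S (e, k). inverse (real (degree ?S x))) =
      (\<Sum>k\<le>r. h k) + (\<Sum>k\<le>r. h (Suc k))"
    by (simp add: sum.distrib)
  also have "(\<Sum>k\<le>r. h k) = h 0 + (\<Sum>k<r. h (Suc k))"
    by (simp add: lessThan_Suc_atMost[symmetric] sum.lessThan_Suc_shift del: sum.lessThan_Suc)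
  also have "(\<Sum>k\<le>r. h (Suc k)) = (\<Sum>k<r. h (Suc k)) + h (Suc r)"
    by (simp add: lessThan_Suc_atMost[symmetric])
  also have "(\<Sum>k<r. h (Suc k)) = real r / 2"
    by (simp add: h')
  finally show ?thesis by (simp add: h)
qed

text \<open>For a tree \<open>T\<close>, each edge outside \<open>T\<close> chooses \<open>r\<close>
  or \<open>x e\<close>; \<open>E'\<close> consists of \<open>T\<close> and the edges that chose
  \<open>r\<close>. Exchanging the sums then counts, for fixed \<open>E'\<close>, the spanning trees
  inside \<open>E'\<close>.\<close>

lemma tree_sum_expand:
  fixes x :: "'e \<Rightarrow> real"
  assumes G: "graph G" and pos: "\<And>e. e \<in> edges G \<Longrightarrow> real r + x e > 0"
  shows "(\<Prod>e\<in>edges G. real r + x e) * tree_sum G (\<lambda>e. inverse (real r + x e)) =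
    (\<Sum>E'\<in>Pow (edges G). real (num_spanning_trees (spanning_subgraph G E')) *
       real r powi (int (card E') - int (card (verts G)) + 1) * (\<Prod>e\<in>edges G - E'. x e))"
proof -
  let ?E = "edges G"
  let ?Tr = "{T. T \<subseteq> ?E \<and> is_tree (spanning_subgraph G T)}"
  have fin: "finite ?E" "finite ?Tr"
    using G by (auto simp: graph_def)
  have tree: "(\<Prod>e\<in>?E. real r + x e) * (\<Prod>e\<in>T. inverse (real r + x e)) =
      (\<Sum>E'\<in>Pow ?E. if T \<subseteq> E' then real r ^ card (E' - T) * (\<Prod>e\<in>?E - E'. x e) else 0)"
    if T: "T \<subseteq> ?E" for T
  proof -
    have "(\<Prod>e\<in>?E. real r + x e) * (\<Prod>e\<in>T. inverse (real r + x e)) =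
        (\<Prod>e\<in>?E - T. real r + x e) * (\<Prod>e\<in>T. (real r + x e) * inverse (real r + x e))"
      using prod.subset_diff[OF T fin(1), of "\<lambda>e. real r + x e"] by (simp add: prod.distrib)
    also have "(\<Prod>e\<in>T. (real r + x e) * inverse (real r + x e)) = 1"
      using pos T by (intro prod.neutral) (auto simp: less_imp_neq[symmetric])
    also have "(\<Prod>e\<in>?E - T. real r + x e) =
        (\<Sum>X\<in>Pow (?E - T). real r ^ card X * (\<Prod>e\<in>?E - T - X. x e))"
      using fin by (subst prod_add) auto
    also have "\<dots> = (\<Sum>E' | T \<subseteq> E' \<and> E' \<subseteq> ?E. real r ^ card (E' - T) * (\<Prod>e\<in>?E - E'. x e))"
    proof (rule sum.reindex_bij_witness[where i = "\<lambda>E'. E' - T" and j = "\<lambda>X. X \<union> T"])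
      fix X assume "X \<in> Pow (?E - T)"
      then have "X \<union> T - T = X" "?E - (X \<union> T) = ?E - T - X" by auto
      then show "X \<union> T - T = X" and "real r ^ card (X \<union> T - T) * (\<Prod>e\<in>?E - (X \<union> T). x e) =
          real r ^ card X * (\<Prod>e\<in>?E - T - X. x e)"
        by simp_all
    qed (use T in auto)
    also have "\<dots> = (\<Sum>E'\<in>Pow ?E. if T \<subseteq> E' then real r ^ card (E' - T) * (\<Prod>e\<in>?E - E'. x e) else 0)"
      using fin by (intro sum.mono_neutral_cong_left) auto
    finally show ?thesis by simp
  qed
  have "(\<Prod>e\<in>?E. real r + x e) * tree_sum G (\<lambda>e. inverse (real r + x e)) =
      (\<Sum>T\<in>?Tr. \<Sum>E'\<in>Pow ?E. if T \<subseteq> E' then real r ^ card (E' - T) * (\<Prod>e\<in>?E - E'. x e) else 0)"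
    unfolding tree_sum_def sum_distrib_left by (intro sum.cong refl tree) auto
  also have "\<dots> = (\<Sum>E'\<in>Pow ?E. \<Sum>T\<in>?Tr.
      if T \<subseteq> E' then real r ^ card (E' - T) * (\<Prod>e\<in>?E - E'. x e) else 0)"
    by (rule sum.swap)
  also have "\<dots> = (\<Sum>E'\<in>Pow ?E. real (num_spanning_trees (spanning_subgraph G E')) *
       real r powi (int (card E') - int (card (verts G)) + 1) * (\<Prod>e\<in>?E - E'. x e))"
  proof (intro sum.cong refl)
    fix E' assume "E' \<in> Pow ?E"
    then have E': "E' \<subseteq> ?E" by simp
    let ?c = "real r powi (int (card E') - int (card (verts G)) + 1) * (\<Prod>e\<in>?E - E'. x e)"
    let ?Tr' = "{T. T \<subseteq> E' \<and> is_tree (spanning_subgraph G T)}"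
    have "(\<Sum>T\<in>?Tr. if T \<subseteq> E' then real r ^ card (E' - T) * (\<Prod>e\<in>?E - E'. x e) else 0) =
        (\<Sum>T\<in>?Tr'. ?c)"
    proof (rule sum.mono_neutral_cong_right)
      fix T assume "T \<in> ?Tr'"
      then have T: "T \<subseteq> E'" "T \<subseteq> ?E" "is_tree (spanning_subgraph G T)" using E' by auto
      have finE': "finite E'" using E' fin by (auto intro: finite_subset)
      then have "card (E' - T) = card E' - card T" "card T \<le> card E'"
        using T by (auto simp: card_Diff_subset finite_subset card_mono)
      \<comment> \<open>As \<open>T\<close> has one edge less than \<open>G\<close> has vertices,
        the exponent depends on \<open>E'\<close> alone and is a natural number whenever
        \<open>E'\<close> contains a tree. Otherwise \<open>?Tr'\<close> is empty, so the value of
        \<open>powi\<close> at a negative exponent does not matter.\<close>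
      then have "int (card E') - int (card (verts G)) + 1 = int (card (E' - T))"
        using card_spanning_tree[OF G T(2,3)] by simp
      then show "(if T \<subseteq> E' then real r ^ card (E' - T) * (\<Prod>e\<in>?E - E'. x e) else 0) = ?c"
        using T by simp
    qed (use fin E' in auto)
    also have "\<dots> = real (num_spanning_trees (spanning_subgraph G E')) * ?c"
      \<comment> \<open>Restricting \<open>G\<close> first to \<open>E'\<close> and then to
        \<open>T\<close> is restricting it to \<open>T\<close>.\<close>
      by (simp add: num_spanning_trees_def spanning_subgraph_def)
    finally show "(\<Sum>T\<in>?Tr. if T \<subseteq> E' then real r ^ card (E' - T) * (\<Prod>e\<in>?E - E'. x e) else 0) =
        real (num_spanning_trees (spanning_subgraph G E')) *
        real r powi (int (card E') - int (card (verts G)) + 1) * (\<Prod>e\<in>?E - E'. x e)"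
      by (simp add: mult_ac)
  qed
  finally show ?thesis .
qed

text \<open>An edge provides a vertex other than \<open>x\<close>, and a walk from \<open>x\<close>
  to it has to start with an edge at \<open>x\<close>.\<close>

lemma connected_graph_degree_pos:
  assumes G: "graph G" and conn: "connected_graph G" and "edges G \<noteq> {}" and x: "x \<in> verts G"
  shows "degree G x > 0"
proof -
  obtain e k l where "e \<in> edges G" "ends G e = {k, l}" "k \<noteq> l" "k \<in> verts G" "l \<in> verts G"
    using G assms(3) by (fastforce simp: graph_def card_2_iff)
  then obtain y where y: "y \<in> verts G" "y \<noteq> x" by metis
  then have "(x, y) \<in> (adjacency G)\<^sup>*" using conn x by (auto simp: connected_graph_def)
  then obtain z where "(x, z) \<in> adjacency G"
    using y by (auto elim: converse_rtranclE)
  then have "{e \<in> edges G. x \<in> ends G e} \<noteq> {}" by (auto simp: adjacency_def)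
  then show ?thesis using G by (simp add: degree_def graph_def card_gt_0_iff)
qed

theorem theorem1p1:
  fixes G :: "('v, 'e) multigraph" and r :: nat and u v :: "'e \<Rightarrow> 'v"
  assumes "graph G"
    and "connected_graph G"
    and "\<And>e. e \<in> edges G \<Longrightarrow> ends G e = {u e, v e}"
  shows "real (num_spanning_trees (line_graph (subdivision r u v G))) =
    (\<Prod>x\<in>verts G. real (degree G x) powi (int (degree G x) - 2)) *
    (\<Sum>E'\<in>Pow (edges G).
       real (num_spanning_trees (spanning_subgraph G E'))
       * real r powi (int (card E') - int (card (verts G)) + 1)
       * (\<Prod>e\<in>edges G - E'. inverse (real (degree G (u e))) + inverse (real (degree G (v e)))))"
proof -
  note G = assms(1) and uv = assms(3)
  have ne: "verts G \<noteq> {}" using assms(2) by (simp add: connected_graph_def)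
  let ?S = "subdivision r u v G"
  show ?thesis
  proof (cases "edges G = {}")
    \<comment> \<open>Without edges every vertex has degree 0, and \<open>0 powi -2\<close> is
      \<open>0\<close> by convention, so the right side vanishes. The line graph has no vertices and
      counts as disconnected, so the left side vanishes too.\<close>
    case True
    obtain a where a: "a \<in> verts G" using ne by auto
    have "real (degree G a) powi (int (degree G a) - 2) = 0"
      using True by (simp add: degree_def power_int_def)
    then have "(\<Prod>x\<in>verts G. real (degree G x) powi (int (degree G x) - 2)) = 0"
      using G a by (intro prod_zero) (auto simp: graph_def)
    moreover have "num_spanning_trees (line_graph ?S) = 0"
      using True by (simp add: num_spanning_trees_def is_tree_def connected_graph_def
          spanning_subgraph_def line_graph_def subdivision_def)
    ultimately show ?thesis by simp
  next
    case False
    let ?x = "\<lambda>e. inverse (real (degree G (u e))) + inverse (real (degree G (v e)))"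
    let ?R = "\<lambda>f. \<Sum>x\<in>ends ?S f. inverse (real (degree ?S x))"
    have S: "graph ?S" by (rule graph_subdivision[OF G uv])
    have verts_S: "verts ?S = Inl ` verts G \<union> Inr ` (edges G \<times> {1..r})"
      and edges_S: "edges ?S = edges G \<times> {0..r}"
      by (simp_all add: subdivision_def)
    have deg_Inr: "degree ?S y = 2" if "y \<in> Inr ` (edges G \<times> {1..r})" for y
      using that by (auto simp: degree_subdivision_Inr)
    have deg_pos: "degree ?S y > 0" if "y \<in> verts ?S" for y
      using that connected_graph_degree_pos[OF G assms(2) False] deg_Inr
      unfolding verts_S by (fastforce simp: degree_subdivision_Inl[OF G uv])
    have R_pos: "?R f > 0" if f: "f \<in> edges ?S" for f
    proof (rule sum_pos)
      show "finite (ends ?S f)" using finite_ends[OF S f] .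
      have "card (ends ?S f) = 2" using S f by (auto simp: graph_def)
      then show "ends ?S f \<noteq> {}" by auto
      show "\<And>x. x \<in> ends ?S f \<Longrightarrow> inverse (real (degree ?S x)) > 0"
        using S f deg_pos by (auto simp: graph_def)
    qed
    have "(\<Prod>y\<in>verts ?S. real (degree ?S y) powi (int (degree ?S y) - 2)) =
        (\<Prod>y\<in>Inl ` verts G. real (degree ?S y) powi (int (degree ?S y) - 2)) *
        (\<Prod>y\<in>Inr ` (edges G \<times> {1..r}). real (degree ?S y) powi (int (degree ?S y) - 2))"
      unfolding verts_S using G by (intro prod.union_disjoint) (auto simp: graph_def)
    \<comment> \<open>Subdividing vertices have degree 2, hence exponent 0.\<close>
    also have "(\<Prod>y\<in>Inr ` (edges G \<times> {1..r}). real (degree ?S y) powi (int (degree ?S y) - 2)) = 1"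
      by (rule prod.neutral) (simp add: deg_Inr)
    also have "(\<Prod>y\<in>Inl ` verts G. real (degree ?S y) powi (int (degree ?S y) - 2)) =
        (\<Prod>x\<in>verts G. real (degree G x) powi (int (degree G x) - 2))"
      by (simp add: prod.reindex degree_subdivision_Inl[OF G uv])
    finally have degrees: "(\<Prod>y\<in>verts ?S. real (degree ?S y) powi (int (degree ?S y) - 2)) =
        (\<Prod>x\<in>verts G. real (degree G x) powi (int (degree G x) - 2))"
      by simp
    have total: "(\<Sum>k\<le>r. ?R (e, k)) = real r + ?x e" if "e \<in> edges G" for e
      using sum_resistances_subdivision[OF G uv that] by simp
    have "(\<Prod>f\<in>edges ?S. ?R f) * tree_sum ?S (\<lambda>f. inverse (?R f)) =
        (\<Prod>e\<in>edges G. \<Sum>k\<le>r. ?R (e, k)) * tree_sum G (\<lambda>e. inverse (\<Sum>k\<le>r. ?R (e, k)))"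
      by (rule tree_sum_subdivision[OF G ne uv]) (use R_pos edges_S in auto)
    also have "(\<Prod>e\<in>edges G. \<Sum>k\<le>r. ?R (e, k)) = (\<Prod>e\<in>edges G. real r + ?x e)"
      by (intro prod.cong refl total)
    also have "tree_sum G (\<lambda>e. inverse (\<Sum>k\<le>r. ?R (e, k))) = tree_sum G (\<lambda>e. inverse (real r + ?x e))"
      unfolding tree_sum_def
      by (intro sum.cong refl prod.cong arg_cong[where f = inverse] total) auto
    also have "(\<Prod>e\<in>edges G. real r + ?x e) * \<dots> =
        (\<Sum>E'\<in>Pow (edges G). real (num_spanning_trees (spanning_subgraph G E')) *
           real r powi (int (card E') - int (card (verts G)) + 1) * (\<Prod>e\<in>edges G - E'. ?x e))"
    proof (rule tree_sum_expand[OF G])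
      fix e assume e: "e \<in> edges G"
      then have "u e \<in> verts G" "v e \<in> verts G"
        using G uv[OF e] by (auto simp: graph_def)
      then have "?x e > 0"
        using connected_graph_degree_pos[OF G assms(2) False] by (simp add: add_pos_pos)
      then show "real r + ?x e > 0" by linarith
    qed
    finally have trees: "(\<Prod>f\<in>edges ?S. ?R f) * tree_sum ?S (\<lambda>f. inverse (?R f)) =
        (\<Sum>E'\<in>Pow (edges G). real (num_spanning_trees (spanning_subgraph G E')) *
           real r powi (int (card E') - int (card (verts G)) + 1) * (\<Prod>e\<in>edges G - E'. ?x e))" .
    have "edges ?S \<noteq> {}" using False by (simp add: edges_S)
    from num_spanning_trees_line_graph[OF S this deg_pos] show ?thesis
      unfolding degrees trees .
  qed
qed

end
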